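(* Let $\mathcal{V}$ be a Banach space, $T>0$, and let $\gamma:[0,T]\to\mathcal{V}$ be a continuous path of vanishing $2$-variation. Then the Riemann–Stieltjes integral $$(s,t)\mapsto\frac12\int_s^t[\gamma(u)-\gamma(s),d\gamma(u)],\qquad 0\le s\le t\le T,$$ is the only possible candidate to enhance $\gamma$ into a geometric $2$-rough path: if $(\gamma,\alpha)$ is a geometric $2$-rough path, then for every $0\le s\le t\le T$ this integral exists and equals $\alpha(s,t)$. Equivalently, if the integral does not exist, or if the pair formed by $\gamma$ and this integral is not a geometric $2$-rough path, then $\gamma$ cannot be enhanced into a geometric $2$-rough path.
   Context: Let $\triangle_{[0,T]}=\{(s,t):0\le s\le t\le T\}$, and for a Banach space $\mathcal{W}$ let $C(\triangle_{[0,T]},\mathcal{W})$ be the continuous $\alpha:\triangle_{[0,T]}\to\mathcal{W}$ with $\alpha(t,t)=0$ for all $t$. For $p>0$, $\|\alpha\|_{p-var}=(\sup_{D}\sum_{j}\|\alpha(t_j,t_{j+1})\|^p)^{1/p}$, sup over all finite partitions $D=\{t_j\}$ of $[0,T]$; for a continuous path $\gamma$, $\|\gamma\|_{p-var}$ is the $p$-variation of $(s,t)\mapsto\gamma(t)-\gamma(s)$. $\gamma$ is of vanishing $2$-variation if $\lim_{\delta\to0}\sup_{|D|\le\delta}\sum_j\|\gamma(t_{j+1})-\gamma(t_j)\|^2=0$, $|D|$ being the mesh. $C^{1-var}([0,T],\mathcal{V})$ is the set of continuous paths of finite $1$-variation. $\mathcal{V}\otimes\mathcal{V}$ is the completion of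 the algebraic tensor product in a norm satisfying $\|v\otimes u\|\le\|v\|\|u\|$; $[v_1,v_2]=v_1\otimes v_2-v_2\otimes v_1$; $[\mathcal{V},\mathcal{V}]$ is the closure in $\mathcal V\otimes\mathcal V$ of the span of all $[v_1,v_2]$. For $\gamma\in C^{1-var}([0,T],\mathcal{V})$ the area is $A(\gamma)(s,t)=\frac12\iint_{s<u_1<u_2<t}[d\gamma(u_1),d\gamma(u_2)]$. The Riemann–Stieltjes integral $\int_s^t[\gamma(u)-\gamma(s),d\gamma(u)]$ is the limit, as the mesh of partitions $\{t_k\}$ of $[s,t]$ tends to $0$, of $\sum_k[\gamma(\xi_k)-\gamma(s),\gamma(t_{k+1})-\gamma(t_k)]$, $\xi_k\in[t_k,t_{k+1}]$. A pair $(\gamma,\alpha)$ with $\gamma\in C([0,T],\mathcal{V})$, $\alpha\in C(\triangle_{[0,T]},[\mathcal{V},\mathcal{V}])$ is a geometric $2$-rough path if there exist $\gamma_n\in C^{1-var}([0,T],\mathcal{V})$ with $\left(\|\gamma-\gamma_n\|_{2-var}^2+\|\alpha-A(\gamma_n)\|_{1-var}\right)^{1/2}\to0$. "$\gamma$ can be enhanced into a geometric $2$-rough path" means that such an $\alpha$ exists. *)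

theory Defs
  imports "HOL-Analysis.Analysis" "HOL-Analysis.Finite_Function_Topology"
begin

text \<open>
  The algebraic tensor product of \<open>'v\<close> with itself is the free vector space
  \<open>('v \<times> 'v, real) poly_mapping\<close> modulo the span of the bilinear relations.
\<close>

definition tensor_relations :: "('v::real_vector \<times> 'v, real) poly_mapping set" where
  "tensor_relations =
     {Poly_Mapping.single (a + b, c) 1 - Poly_Mapping.single (a, c) 1
        - Poly_Mapping.single (b, c) 1 | a b c. True} \<union>
     {Poly_Mapping.single (a, b + c) 1 - Poly_Mapping.single (a, b) 1
        - Poly_Mapping.single (a, c) 1 | a b c. True} \<union>
     {Poly_Mapping.single (r *\<^sub>R a, b) 1 - r *\<^sub>R Poly_Mapping.single (a, b) 1 | r a b. True} \<union>
     {Poly_Mapping.single (a, r *\<^sub>R b) 1 - r *\<^sub>R Poly_Mapping.single (a, b) 1 | r a b. True}"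

definition eval_tensor ::
  "('v::real_vector \<Rightarrow> 'v \<Rightarrow> 'w::real_vector) \<Rightarrow> ('v \<times> 'v, real) poly_mapping \<Rightarrow> 'w" where
  "eval_tensor B p =
     (\<Sum>x\<in>Poly_Mapping.keys p. Poly_Mapping.lookup p x *\<^sub>R B (fst x) (snd x))"

text \<open>
  \<open>B v u\<close> plays the role of \<open>v \<otimes> u\<close>. The first two conditions say that \<open>B\<close> induces a
  well-defined injective linear map from the algebraic tensor product into the Banach space
  \<open>'w\<close>; its image, the span of the range of \<open>B\<close>, carries the tensor norm and is dense.
\<close>

definition is_completed_tensor :: "('v::banach \<Rightarrow> 'v \<Rightarrow> 'w::banach) \<Rightarrow> bool" where
  "is_completed_tensor B \<longleftrightarrow>
     bilinear B \<and>
     (\<forall>p. eval_tensor B p = 0 \<longrightarrow> p \<in> span tensor_relations) \<and>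
     closure (span (range (\<lambda>(v, u). B v u))) = UNIV \<and>
     (\<forall>v u. norm (B v u) \<le> norm v * norm u)"

definition commutator :: "('v \<Rightarrow> 'v \<Rightarrow> 'w::real_normed_vector) \<Rightarrow> 'v \<Rightarrow> 'v \<Rightarrow> 'w" where
  "commutator B v u = B v u - B u v"

definition commutator_space :: "('v \<Rightarrow> 'v \<Rightarrow> 'w::real_normed_vector) \<Rightarrow> 'w set" where
  "commutator_space B = closure (span (range (\<lambda>(v, u). commutator B v u)))"

definition is_partition :: "real \<Rightarrow> real \<Rightarrow> real list \<Rightarrow> bool" where
  "is_partition a b ts \<longleftrightarrow> ts \<noteq> [] \<and> sorted_wrt (<) ts \<and> hd ts = a \<and> last ts = b"

text \<open>Inserting 0 gives the one-point partition of a degenerate interval mesh 0.\<close>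

definition mesh :: "real list \<Rightarrow> real" where
  "mesh ts = Max (insert 0 ((\<lambda>j. ts ! Suc j - ts ! j) ` {..<length ts - 1}))"

definition ennreal_powr :: "ennreal \<Rightarrow> real \<Rightarrow> ennreal" where
  "ennreal_powr x r = (if x = top then top else ennreal (enn2real x powr r))"

definition var_sum :: "real \<Rightarrow> (real \<Rightarrow> real \<Rightarrow> 'a::real_normed_vector) \<Rightarrow> real list \<Rightarrow> real" where
  "var_sum p f ts = (\<Sum>j<length ts - 1. norm (f (ts ! j) (ts ! Suc j)) powr p)"

definition p_var :: "real \<Rightarrow> real \<Rightarrow> (real \<Rightarrow> real \<Rightarrow> 'a::real_normed_vector) \<Rightarrow> ennreal" where
  "p_var T p f = ennreal_powr (SUP D\<in>{D. is_partition 0 T D}. ennreal (var_sum p f D)) (1 / p)"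

definition increments :: "(real \<Rightarrow> 'a::real_normed_vector) \<Rightarrow> real \<Rightarrow> real \<Rightarrow> 'a" where
  "increments \<gamma> s t = \<gamma> t - \<gamma> s"

definition vanishing_2_variation :: "real \<Rightarrow> (real \<Rightarrow> 'a::real_normed_vector) \<Rightarrow> bool" where
  "vanishing_2_variation T \<gamma> \<longleftrightarrow>
     ((\<lambda>\<delta>. SUP D\<in>{D. is_partition 0 T D \<and> mesh D \<le> \<delta>}. ennreal (var_sum 2 (increments \<gamma>) D))
        \<longlongrightarrow> 0) (at_right 0)"

definition C_1var :: "real \<Rightarrow> (real \<Rightarrow> 'a::real_normed_vector) set" where
  "C_1var T = {\<gamma>. continuous_on {0..T} \<gamma> \<and> p_var T 1 (increments \<gamma>) < top}"

text \<open>Only the values on the triangle matter; \<open>\<alpha>\<close> is arbitrary elsewhere.\<close>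

definition C_triangle ::
  "real \<Rightarrow> 'w::real_normed_vector set \<Rightarrow> (real \<Rightarrow> real \<Rightarrow> 'w) set" where
  "C_triangle T W =
     {\<alpha>. continuous_on {(s, t). 0 \<le> s \<and> s \<le> t \<and> t \<le> T} (\<lambda>(s, t). \<alpha> s t) \<and>
         (\<forall>s t. 0 \<le> s \<and> s \<le> t \<and> t \<le> T \<longrightarrow> \<alpha> s t \<in> W) \<and>
         (\<forall>t\<in>{0..T}. \<alpha> t t = 0)}"

definition rs_sum ::
  "('a \<Rightarrow> 'b::real_normed_vector \<Rightarrow> 'c::real_normed_vector)
     \<Rightarrow> (real \<Rightarrow> 'a) \<Rightarrow> (real \<Rightarrow> 'b) \<Rightarrow> real list \<Rightarrow> (nat \<Rightarrow> real) \<Rightarrow> 'c" where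
  "rs_sum B f g ts \<xi> = (\<Sum>k<length ts - 1. B (f (\<xi> k)) (g (ts ! Suc k) - g (ts ! k)))"

definition has_rs_integral ::
  "('a \<Rightarrow> 'b::real_normed_vector \<Rightarrow> 'c::real_normed_vector)
     \<Rightarrow> (real \<Rightarrow> 'a) \<Rightarrow> (real \<Rightarrow> 'b) \<Rightarrow> real \<Rightarrow> real \<Rightarrow> 'c \<Rightarrow> bool" where
  "has_rs_integral B f g a b I \<longleftrightarrow>
     (\<forall>\<epsilon>>0. \<exists>\<delta>>0. \<forall>ts \<xi>.
        is_partition a b ts \<and> mesh ts \<le> \<delta> \<and>
        (\<forall>k<length ts - 1. \<xi> k \<in> {ts ! k..ts ! Suc k})
        \<longrightarrow> norm (rs_sum B f g ts \<xi> - I) < \<epsilon>)"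

definition rs_integrable ::
  "('a \<Rightarrow> 'b::real_normed_vector \<Rightarrow> 'c::real_normed_vector)
     \<Rightarrow> (real \<Rightarrow> 'a) \<Rightarrow> (real \<Rightarrow> 'b) \<Rightarrow> real \<Rightarrow> real \<Rightarrow> bool" where
  "rs_integrable B f g a b \<longleftrightarrow> (\<exists>I. has_rs_integral B f g a b I)"

definition rs_integral ::
  "('a \<Rightarrow> 'b::real_normed_vector \<Rightarrow> 'c::real_normed_vector)
     \<Rightarrow> (real \<Rightarrow> 'a) \<Rightarrow> (real \<Rightarrow> 'b) \<Rightarrow> real \<Rightarrow> real \<Rightarrow> 'c" where
  "rs_integral B f g a b = (THE I. has_rs_integral B f g a b I)"

text \<open>
  The double integral over \<open>s < u1 < u2 < t\<close> is the iterated Riemann--Stieltjes integral, with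
  inner integral \<open>\<integral> d\<gamma>(u1)\<close> over \<open>s < u1 < u2\<close>.
\<close>

definition area ::
  "('v::real_normed_vector \<Rightarrow> 'v \<Rightarrow> 'w::real_normed_vector)
     \<Rightarrow> (real \<Rightarrow> 'v) \<Rightarrow> real \<Rightarrow> real \<Rightarrow> 'w" where
  "area B \<gamma> s t =
     (1/2) *\<^sub>R rs_integral (commutator B)
       (\<lambda>u2. rs_integral (*\<^sub>R) (\<lambda>u1. 1) \<gamma> s u2) \<gamma> s t"

definition geometric_2_rough_path ::
  "('v::real_normed_vector \<Rightarrow> 'v \<Rightarrow> 'w::real_normed_vector)
     \<Rightarrow> real \<Rightarrow> (real \<Rightarrow> 'v) \<Rightarrow> (real \<Rightarrow> real \<Rightarrow> 'w) \<Rightarrow> bool" where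
  "geometric_2_rough_path B T \<gamma> \<alpha> \<longleftrightarrow>
     continuous_on {0..T} \<gamma> \<and>
     \<alpha> \<in> C_triangle T (commutator_space B) \<and>
     (\<exists>\<gamma>n :: nat \<Rightarrow> real \<Rightarrow> 'v.
        (\<forall>n. \<gamma>n n \<in> C_1var T) \<and>
        (\<lambda>n. ennreal_powr
               ((p_var T 2 (increments (\<lambda>u. \<gamma> u - \<gamma>n n u)))\<^sup>2
                 + p_var T 1 (\<lambda>s t. \<alpha> s t - area B (\<gamma>n n) s t)) (1/2))
          \<longlonglongrightarrow> 0)"

definition can_be_enhanced ::
  "('v::real_normed_vector \<Rightarrow> 'v \<Rightarrow> 'w::real_normed_vector)
     \<Rightarrow> real \<Rightarrow> (real \<Rightarrow> 'v) \<Rightarrow> bool" where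
  "can_be_enhanced B T \<gamma> \<longleftrightarrow> (\<exists>\<alpha>. geometric_2_rough_path B T \<gamma> \<alpha>)"

end

theory Submission
  imports Defs
begin

text \<open>
  Chen's relation passes from the areas of the approximating paths to \<open>\<alpha>\<close>, so that for every
  partition of \<open>[s, t]\<close> the quantity \<open>2 \<alpha> s t\<close> minus the left Riemann sum of the integral is exactly
  twice the sum of \<open>\<alpha>\<close> over the partition intervals. This sum tends to 0 with the mesh: it is
  close to the corresponding sum for the area of a path of bounded variation, uniformly in the
  partition, and the latter is at most a constant times the oscillation at the scale of the mesh
  times the total variation. Vanishing 2-variation of \<open>\<gamma>\<close> is only needed to pass from left
  endpoints to arbitrary tags.
\<close>

section \<open>Partitions\<close>

text \<open>Integrating \<gamma> against itself at 2-variation is the borderline case in which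
  Young's estimate fails, so existence is not proved by a Cauchy argument: \<alpha> s t is given
  beforehand, and the exact identity exhibits it as the limit. The order of choices is essential.
  The approximating path is fixed first, from the wanted accuracy alone; the mesh comes afterwards
  and may depend on the modulus of continuity and the total variation of that path. The 1-variation
  norm permits this, since it bounds the error over all partitions at once. The areas of a regular
  path have small sums because the integrand over [x, y] is the increment from x, the left end of
  that very interval. The cross term in Chen's relation is the price of moving this base point.
  Areas are definite descriptions, so they say nothing until the integral of a continuous function
  against a path of bounded variation is shown to exist. This is where completeness of the target
  space enters.\<close>

definition chain_sum :: "('b \<Rightarrow> 'b \<Rightarrow> 'a::comm_monoid_add) \<Rightarrow> 'b list \<Rightarrow> 'a" where
  "chain_sum f ts = (\<Sum>j<length ts - 1. f (ts ! j) (ts ! Suc j))"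

lemma chain_sum_single [simp]: "chain_sum f [x] = 0"
  by (simp add: chain_sum_def)

lemma chain_sum_Cons2 [simp]: "chain_sum f (x # y # zs) = f x y + chain_sum f (y # zs)"
  by (simp add: chain_sum_def sum.lessThan_Suc_shift del: sum.lessThan_Suc)

lemma var_sum_eq: "var_sum p f = chain_sum (\<lambda>a b. norm (f a b) powr p)"
  by (simp add: fun_eq_iff var_sum_def chain_sum_def)

lemma mesh_single [simp]: "mesh [x] = 0"
  by (simp add: mesh_def)

lemma mesh_nonneg: "0 \<le> mesh ts"
  by (auto simp: mesh_def)

lemma mesh_Cons2 [simp]: "mesh (x # y # zs) = max (y - x) (mesh (y # zs))"
proof -
  let ?f = "\<lambda>ts j. ts ! Suc j - ts ! j :: real"
  have "?f (x # y # zs) ` {..<length (x # y # zs) - 1}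
      = insert (y - x) (?f (y # zs) ` {..<length (y # zs) - 1})"
    by (simp add: lessThan_Suc_eq_insert_0 image_image)
  then show ?thesis
    unfolding mesh_def by (simp add: insert_commute[of 0] del: length_Cons)
qed

lemma is_partition_single [simp]: "is_partition a b [x] \<longleftrightarrow> x = a \<and> x = b"
  by (auto simp: is_partition_def)

lemma is_partition_Cons2 [simp]:
  "is_partition a b (x # y # zs) \<longleftrightarrow> x = a \<and> x < y \<and> is_partition y b (y # zs)"
  by (auto simp: is_partition_def)

text \<open>The right end \<open>b\<close> stays fixed while the first interval is peeled off, so
  properties of sums and meshes follow from the list recursions. The base case forces
  \<open>a = b\<close>.\<close>

lemma partition_induct [consumes 1, case_names single Cons]:
  assumes "is_partition a b ts"
    and "P b [b]"
    and "\<And>a c r. a < c \<Longrightarrow> is_partition c b (c # r) \<Longrightarrow> P c (c # r) \<Longrightarrow> P a (a # c # r)"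
  shows "P a ts"
  using assms(1)
proof (induction ts arbitrary: a)
  case Nil
  then show ?case by (simp add: is_partition_def)
next
  case (Cons x xs)
  show ?case
  proof (cases xs)
    case Nil
    with Cons.prems assms(2) show ?thesis by auto
  next
    case (Cons y ys)
    with Cons.prems Cons.IH[of y] assms(3)[of x y ys] show ?thesis by simp
  qed
qed

lemma partition_bounds:
  assumes "is_partition a b ts" "x \<in> set ts"
  shows "a \<le> x \<and> x \<le> b"
  using assms(1,2)
proof (induction arbitrary: x rule: partition_induct)
  case (Cons a c r)
  from Cons.IH[of c] Cons.IH[of x] Cons.hyps Cons.prems show ?case by auto
qed auto

lemma partition_le: "is_partition a b ts \<Longrightarrow> a \<le> b"
  by (induction rule: partition_induct) auto

lemma partition_hd_in: "is_partition a b ts \<Longrightarrow> a \<in> set ts"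
  by (auto simp: is_partition_def)

lemma partition_Cons: "is_partition a b ts \<Longrightarrow> \<exists>r. ts = a # r"
  by (cases ts) (auto simp: is_partition_def)

lemma partition_tags_bounds:
  assumes "is_partition a b ts" "k < length ts - 1" "x \<in> {ts ! k..ts ! Suc k}"
  shows "x \<in> {a..b}"
proof -
  have "ts ! k \<in> set ts" "ts ! Suc k \<in> set ts"
    using assms(2) by auto
  with partition_bounds[OF assms(1)] assms(3) show ?thesis
    by fastforce
qed

lemma partition_nth_less:
  assumes "is_partition a b ts" "k < length ts - 1"
  shows "ts ! k < ts ! Suc k"
  using assms by (auto simp: is_partition_def sorted_wrt_nth_less)

text \<open>\<open>tl Q\<close> drops the shared point \<open>b\<close>, which would otherwise break
  strict monotonicity.\<close>

lemma partition_join: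
  assumes "is_partition a b P" "is_partition b c Q"
  shows "is_partition a c (P @ tl Q)"
    and "chain_sum f (P @ tl Q) = chain_sum f P + chain_sum f Q"
    and "mesh (P @ tl Q) = max (mesh P) (mesh Q)"
proof -
  have "is_partition a c (P @ tl Q) \<and> chain_sum f (P @ tl Q) = chain_sum f P + chain_sum f Q \<and>
    mesh (P @ tl Q) = max (mesh P) (mesh Q)"
    using assms(1)
  proof (induction rule: partition_induct)
    case single
    with assms(2) partition_Cons[OF assms(2)] show ?case by (auto simp: mesh_nonneg)
  next
    case (Cons a d r)
    then show ?case by (simp add: add.assoc max.assoc)
  qed
  then show "is_partition a c (P @ tl Q)"
    and "chain_sum f (P @ tl Q) = chain_sum f P + chain_sum f Q"
    and "mesh (P @ tl Q) = max (mesh P) (mesh Q)" by auto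
qed

text \<open>The induction is on a bound \<open>n\<close> for the number of steps of length \<delta>
  from \<open>a\<close> to \<open>b\<close>; each step moves the left end by \<delta>.\<close>

lemma fine_partition_exists:
  assumes "a \<le> b" "0 < \<delta>"
  obtains ts where "is_partition a b ts" "mesh ts \<le> \<delta>"
proof -
  obtain n :: nat where "b - a \<le> real n * \<delta>"
    using reals_Archimedean3[OF assms(2)] by (meson less_imp_le)
  then have "\<exists>ts. is_partition a b ts \<and> mesh ts \<le> \<delta>"
    using assms(1)
  proof (induction n arbitrary: a)
    case 0
    then have "is_partition a b [a]" by simp
    then show ?case using assms(2) by fastforce
  next
    case (Suc n)
    show ?case
    proof (cases "b - a \<le> \<delta>")
      case True
      show ?thesis
      \<comment> \<open>Points of a partition increase strictly, so for \<open>a = b\<close> the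
        list \<open>[a, b]\<close> would not be one.\<close>
      proof (cases "a = b")
        case True
        then have "is_partition a b [a]" by simp
        then show ?thesis using assms(2) by fastforce
      next
        case False
        with Suc.prems True assms(2) have "is_partition a b [a, b] \<and> mesh [a, b] \<le> \<delta>" by simp
        then show ?thesis by blast
      qed
    next
      case False
      with Suc.prems have "b - (a + \<delta>) \<le> real n * \<delta>" "a + \<delta> \<le> b"
        by (simp_all add: algebra_simps)
      from Suc.IH[OF this] obtain ts where ts: "is_partition (a + \<delta>) b ts" "mesh ts \<le> \<delta>" by blast
      with partition_Cons obtain r where "ts = (a + \<delta>) # r" by blast
      with ts assms(2) have "is_partition a b (a # ts)" "mesh (a # ts) \<le> \<delta>" by auto
      then show ?thesis by blast
    qed
  qed
  with that show ?thesis by blast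
qed

lemma chain_sum_mono:
  fixes f g :: "'b \<Rightarrow> 'b \<Rightarrow> 'a::ordered_comm_monoid_add"
  assumes "\<And>x y. x \<in> set ts \<Longrightarrow> y \<in> set ts \<Longrightarrow> f x y \<le> g x y"
  shows "chain_sum f ts \<le> chain_sum g ts"
  unfolding chain_sum_def by (intro sum_mono assms nth_mem) auto

lemma chain_sum_nonneg:
  fixes h :: "'b \<Rightarrow> 'b \<Rightarrow> real"
  shows "(\<And>x y. 0 \<le> h x y) \<Longrightarrow> 0 \<le> chain_sum h ts"
  by (simp add: chain_sum_def sum_nonneg)

text \<open>Variation hypotheses speak of partitions of the whole of [0, T], while sums are needed
  over [s, t]. Padding with fine partitions on both sides keeps the mesh bound and only adds
  nonnegative terms.\<close>

lemma partition_extend: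
  fixes h :: "real \<Rightarrow> real \<Rightarrow> real"
  assumes "is_partition s t D" "a \<le> s" "t \<le> b" "0 < \<delta>" "mesh D \<le> \<delta>" "\<And>x y. 0 \<le> h x y"
  obtains D' where "is_partition a b D'" "mesh D' \<le> \<delta>" "chain_sum h D \<le> chain_sum h D'"
proof -
  obtain P where P: "is_partition a s P" "mesh P \<le> \<delta>"
    using fine_partition_exists assms(2,4) by blast
  obtain Q where Q: "is_partition t b Q" "mesh Q \<le> \<delta>"
    using fine_partition_exists assms(3,4) by blast
  note PD = partition_join[OF P(1) assms(1)]
  note PDQ = partition_join[OF PD(1) Q(1)]
  have "chain_sum h D \<le> chain_sum h ((P @ tl D) @ tl Q)"
    unfolding PDQ(2) PD(2) using chain_sum_nonneg[of h P] chain_sum_nonneg[of h Q] assms(6) by simp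
  moreover have "mesh ((P @ tl D) @ tl Q) \<le> \<delta>"
    unfolding PDQ(3) PD(3) using P(2) Q(2) assms(5) by simp
  ultimately show ?thesis using that PDQ(1) by blast
qed

lemma chain_sum_extend_le:
  fixes h :: "real \<Rightarrow> real \<Rightarrow> real"
  assumes "is_partition s t D" "a \<le> s" "t \<le> b" "\<And>x y. 0 \<le> h x y"
    and "\<And>D. is_partition a b D \<Longrightarrow> chain_sum h D \<le> V"
  shows "chain_sum h D \<le> V"
proof -
  \<comment> \<open>Any positive mesh bound serves here; \<open>mesh D\<close> alone may be
    0.\<close>
  obtain D' where "is_partition a b D'" "mesh D' \<le> mesh D + 1" "chain_sum h D \<le> chain_sum h D'"
    using partition_extend[OF assms(1-3), of "mesh D + 1" h] mesh_nonneg[of D] assms(4) by auto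
  with assms(5) show ?thesis by fastforce
qed

lemma chain_sum_telescope:
  fixes g :: "real \<Rightarrow> 'a::ab_group_add"
  assumes "is_partition a b ts"
  shows "chain_sum (\<lambda>x y. g y - g x) ts = g b - g a"
  using assms by (induction rule: partition_induct) auto

lemma norm_chain_sum_le: "norm (chain_sum f ts) \<le> chain_sum (\<lambda>x y. norm (f x y)) ts"
  unfolding chain_sum_def by (rule norm_sum)

lemma chain_sum_diff:
  "chain_sum f ts - chain_sum g ts = chain_sum (\<lambda>x y. f x y - g x y :: 'a::ab_group_add) ts"
  by (simp add: chain_sum_def sum_subtractf)

lemma chain_sum_distrib_left: "c * chain_sum f ts = chain_sum (\<lambda>x y. c * f x y) ts"
  for c :: "'a::semiring_0"
  by (simp add: chain_sum_def sum_distrib_left)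

lemma (in bounded_bilinear) chain_sum_right:
  "chain_sum (\<lambda>x y. prod c (f x y)) ts = prod c (chain_sum f ts)"
  by (simp add: chain_sum_def sum_right)

section \<open>Riemann--Stieltjes integrals\<close>

text \<open>The tag condition of \<open>has_rs_integral\<close>, named so that it obeys a list
  recursion; on the tail of the list the tags are shifted by \<open>Suc\<close>.\<close>

definition tags :: "real list \<Rightarrow> (nat \<Rightarrow> real) \<Rightarrow> bool" where
  "tags ts \<xi> \<longleftrightarrow> (\<forall>k<length ts - 1. \<xi> k \<in> {ts ! k..ts ! Suc k})"

lemma tags_Cons2 [simp]:
  "tags (x # y # zs) \<xi> \<longleftrightarrow> x \<le> \<xi> 0 \<and> \<xi> 0 \<le> y \<and> tags (y # zs) (\<lambda>k. \<xi> (Suc k))"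
  by (auto simp: tags_def less_Suc_eq_0_disj)

lemma has_rs_integral_tags:
  "has_rs_integral B f g a b I \<longleftrightarrow>
     (\<forall>\<epsilon>>0. \<exists>\<delta>>0. \<forall>ts \<xi>. is_partition a b ts \<and> mesh ts \<le> \<delta> \<and> tags ts \<xi>
        \<longrightarrow> norm (rs_sum B f g ts \<xi> - I) < \<epsilon>)"
  by (simp add: has_rs_integral_def tags_def)

lemma rs_sum_single [simp]: "rs_sum B f g [x] \<xi> = 0"
  by (simp add: rs_sum_def)

lemma rs_sum_Cons2 [simp]:
  "rs_sum B f g (x # y # zs) \<xi> = B (f (\<xi> 0)) (g y - g x) + rs_sum B f g (y # zs) (\<lambda>k. \<xi> (Suc k))"
  by (simp add: rs_sum_def sum.lessThan_Suc_shift del: sum.lessThan_Suc)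

abbreviation left_sum ::
  "('a \<Rightarrow> 'b::real_normed_vector \<Rightarrow> 'c::real_normed_vector)
     \<Rightarrow> (real \<Rightarrow> 'a) \<Rightarrow> (real \<Rightarrow> 'b) \<Rightarrow> real list \<Rightarrow> 'c" where
  "left_sum B f g \<equiv> chain_sum (\<lambda>x y. B (f x) (g y - g x))"

lemma rs_sum_left: "rs_sum B f g ts ((!) ts) = left_sum B f g ts"
  by (simp add: rs_sum_def chain_sum_def)

lemma tags_left: "is_partition a b ts \<Longrightarrow> tags ts ((!) ts)"
  using partition_nth_less[of a b ts] by (simp add: tags_def less_imp_le)

lemma has_rs_integral_left:
  assumes "has_rs_integral B f g a b I" "0 < \<epsilon>"
  obtains \<delta> where "0 < \<delta>"
    "\<And>ts. is_partition a b ts \<Longrightarrow> mesh ts \<le> \<delta> \<Longrightarrow> norm (left_sum B f g ts - I) < \<epsilon>"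
proof -
  obtain \<delta> where \<delta>: "0 < \<delta>"
    "\<forall>ts \<xi>. is_partition a b ts \<and> mesh ts \<le> \<delta> \<and> tags ts \<xi> \<longrightarrow> norm (rs_sum B f g ts \<xi> - I) < \<epsilon>"
    using assms unfolding has_rs_integral_tags by blast
  show ?thesis
    by (rule that[OF \<delta>(1)]) (use \<delta>(2) tags_left in \<open>fastforce simp flip: rs_sum_left\<close>)
qed

text \<open>One left sum on a fine partition is close to both values. Such a partition requires
  \<open>a \<le> b\<close>: for \<open>b < a\<close> there is none, and every value is vacuously an
  integral.\<close>

lemma has_rs_integral_unique:
  assumes "has_rs_integral B f g a b I" "has_rs_integral B f g a b J" "a \<le> b"
  shows "I = J"
proof (rule ccontr)
  assume "I \<noteq> J"
  then have e: "0 < norm (I - J) / 2" by simp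
  obtain \<delta>1 where 1: "0 < \<delta>1"
    "\<And>ts. is_partition a b ts \<Longrightarrow> mesh ts \<le> \<delta>1 \<Longrightarrow> norm (left_sum B f g ts - I) < norm (I - J) / 2"
    using has_rs_integral_left[OF assms(1) e] by blast
  obtain \<delta>2 where 2: "0 < \<delta>2"
    "\<And>ts. is_partition a b ts \<Longrightarrow> mesh ts \<le> \<delta>2 \<Longrightarrow> norm (left_sum B f g ts - J) < norm (I - J) / 2"
    using has_rs_integral_left[OF assms(2) e] by blast
  obtain ts where "is_partition a b ts" "mesh ts \<le> min \<delta>1 \<delta>2"
    using fine_partition_exists[OF assms(3), of "min \<delta>1 \<delta>2"] 1(1) 2(1) by auto
  with 1(2)[of ts] 2(2)[of ts]
  have "norm (I - left_sum B f g ts) < norm (I - J) / 2" "norm (J - left_sum B f g ts) < norm (I - J) / 2"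
    by (auto simp: norm_minus_commute)
  then have "norm (I - J) < norm (I - J)"
    by (rule norm_triangle_half_l)
  then show False by simp
qed

lemma rs_integral_eq:
  assumes "has_rs_integral B f g a b I" "a \<le> b"
  shows "rs_integral B f g a b = I"
  unfolding rs_integral_def
  by (rule the_equality) (use assms has_rs_integral_unique in blast)+

lemma has_rs_integral_rs_integral:
  assumes "rs_integrable B f g a b" "a \<le> b"
  shows "has_rs_integral B f g a b (rs_integral B f g a b)"
proof -
  obtain I where "has_rs_integral B f g a b I"
    using assms(1) unfolding rs_integrable_def by blast
  with rs_integral_eq[OF this assms(2)] show ?thesis by simp
qed

text \<open>Stated as an equality of predicates, so that it can be substituted under the
  \<open>THE\<close> in \<open>rs_integral\<close>.\<close>

lemma has_rs_integral_cong:
  assumes "\<And>x. x \<in> {a..b} \<Longrightarrow> f x = f' x"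
  shows "has_rs_integral B f g a b = has_rs_integral B f' g a b"
proof -
  have "rs_sum B f g ts \<xi> = rs_sum B f' g ts \<xi>"
    if "is_partition a b ts" "tags ts \<xi>" for ts \<xi>
    using that assms partition_tags_bounds[OF that(1)]
    unfolding rs_sum_def tags_def by (intro sum.cong) auto
  then have "(is_partition a b ts \<and> mesh ts \<le> \<delta> \<and> tags ts \<xi> \<longrightarrow> norm (rs_sum B f g ts \<xi> - I) < \<epsilon>)
      \<longleftrightarrow> (is_partition a b ts \<and> mesh ts \<le> \<delta> \<and> tags ts \<xi> \<longrightarrow> norm (rs_sum B f' g ts \<xi> - I) < \<epsilon>)"
    for ts \<xi> \<delta> \<epsilon> I
    by auto
  then show ?thesis
    by (intro ext) (simp only: has_rs_integral_tags)
qed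

lemma has_rs_integral_one: "has_rs_integral (*\<^sub>R) (\<lambda>u. 1) g a b (g b - g a)"
proof -
  have "rs_sum (*\<^sub>R) (\<lambda>u. 1) g ts \<xi> = chain_sum (\<lambda>x y. g y - g x) ts" for ts \<xi>
    by (simp add: rs_sum_def chain_sum_def)
  then show ?thesis
    unfolding has_rs_integral_def by (auto simp: chain_sum_telescope intro!: exI[of _ 1])
qed

text \<open>The inner integral of the constant 1 telescopes, which turns the iterated integral into
  the single integral of the theorem.\<close>

lemma area_eq:
  "area B g s t = (1/2) *\<^sub>R rs_integral (commutator B) (\<lambda>u. g u - g s) g s t"
proof -
  have "rs_integral (*\<^sub>R) (\<lambda>u1. 1) g s u = g u - g s" if "u \<in> {s..t}" for u
    using that by (intro rs_integral_eq has_rs_integral_one) auto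
  then show ?thesis
    unfolding area_def rs_integral_def[of "commutator B"] by (subst has_rs_integral_cong) auto
qed

section \<open>Continuous integrands against paths of bounded variation\<close>

text \<open>Telescoping \<open>g b - g a\<close> along \<open>P\<close> gives both sides the same
  increments, so only the differences \<open>z - f x\<close> remain. Used with a tag value for
  \<open>z\<close> when refining, and with \<open>z = 0\<close> to bound a left sum itself.\<close>

lemma left_sum_osc_bound:
  assumes C: "bounded_bilinear C" and K: "\<And>x y. norm (C x y) \<le> K * norm x * norm y"
    and P: "is_partition a b P"
    and osc: "\<And>x. x \<in> {a..b} \<Longrightarrow> norm (z - f x) \<le> \<epsilon>" and "0 \<le> K"
  shows "norm (C z (g b - g a) - left_sum C f g P)
      \<le> K * \<epsilon> * chain_sum (\<lambda>x y. norm (g y - g x)) P"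
proof -
  interpret bounded_bilinear C by fact
  have "C z (g b - g a) = chain_sum (\<lambda>x y. C z (g y - g x)) P"
    by (simp add: chain_sum_right chain_sum_telescope[OF P])
  then have "C z (g b - g a) - left_sum C f g P = chain_sum (\<lambda>x y. C (z - f x) (g y - g x)) P"
    by (simp add: chain_sum_diff diff_left)
  also have "norm \<dots> \<le> chain_sum (\<lambda>x y. norm (C (z - f x) (g y - g x))) P"
    by (rule norm_chain_sum_le)
  also have "\<dots> \<le> chain_sum (\<lambda>x y. K * \<epsilon> * norm (g y - g x)) P"
  proof (intro chain_sum_mono)
    fix x y assume "x \<in> set P"
    then have "norm (z - f x) \<le> \<epsilon>"
      using osc partition_bounds[OF P] by auto
    then show "norm (C (z - f x) (g y - g x)) \<le> K * \<epsilon> * norm (g y - g x)"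
      using K[of "z - f x" "g y - g x"] \<open>0 \<le> K\<close> by (smt (verit) mult_left_mono mult_right_mono norm_ge_zero)
  qed
  finally show ?thesis by (simp add: chain_sum_distrib_left)
qed

lemma partition_split:
  assumes "is_partition a b us" "c \<in> set us"
  obtains P Q where "is_partition a c P" "is_partition c b Q" "us = P @ tl Q"
proof -
  have "\<exists>P Q. is_partition a c P \<and> is_partition c b Q \<and> us = P @ tl Q"
    using assms
  proof (induction rule: partition_induct)
    case single
    then show ?case by (intro exI[of _ "[b]"]) auto
  next
    case (Cons a d r)
    show ?case
    proof (cases "c = a")
      case True
      with Cons show ?thesis by (intro exI[of _ "[a]"] exI[of _ "a # d # r"]) auto
    next
      case False
      with Cons obtain P Q where PQ: "is_partition d c P" "is_partition c b Q" "d # r = P @ tl Q"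
        by auto
      with partition_Cons[OF PQ(1)] Cons show ?thesis
        by (intro exI[of _ "a # P"] exI[of _ Q]) auto
    qed
  qed
  with that show ?thesis by blast
qed

text \<open>On each interval of \<open>ts\<close> the tagged term is compared with the left sum over
  the piece of \<open>us\<close> inside it. The variation on the right is taken along
  \<open>us\<close>, so the pieces add up without loss.\<close>

lemma rs_sum_refine_bound:
  assumes C: "bounded_bilinear C" and K: "\<And>x y. norm (C x y) \<le> K * norm x * norm y" "0 \<le> K"
    and "is_partition a b ts" "is_partition a b us" "set ts \<subseteq> set us" "tags ts \<xi>" "mesh ts \<le> \<delta>"
    and "\<And>x y. x \<in> {a..b} \<Longrightarrow> y \<in> {a..b} \<Longrightarrow> \<bar>x - y\<bar> \<le> \<delta> \<Longrightarrow> norm (f x - f y) \<le> \<epsilon>"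
  shows "norm (rs_sum C f g ts \<xi> - left_sum C f g us)
      \<le> K * \<epsilon> * chain_sum (\<lambda>x y. norm (g y - g x)) us"
  using assms(4-9)
proof (induction arbitrary: us \<xi> rule: partition_induct)
  case single
  then have "us = [b]"
  proof -
    obtain r where r: "us = b # r"
      using partition_Cons single.prems(1) by blast
    show ?thesis
    proof (cases r)
      case (Cons y ys)
      then have "b < y" "is_partition y b (y # ys)"
        using single.prems(1) r by auto
      then show ?thesis using partition_le[of y b] by fastforce
    qed (use r in simp)
  qed
  then show ?case by simp
next
  case (Cons a c r)
  then obtain P Q where PQ: "is_partition a c P" "is_partition c b Q" "us = P @ tl Q"
    by (auto intro: partition_split[of a b us c])
  have "c \<le> b" using Cons.hyps partition_le by blast
  \<comment> \<open>The induction hypothesis needs \<open>Q\<close> to refine the tail; a point of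
    the tail that landed in \<open>P\<close> can only be the cut point \<open>c\<close>.\<close>
  have "set (c # r) \<subseteq> set Q"
  proof
    fix x assume x: "x \<in> set (c # r)"
    then have "x \<in> set us" and le: "c \<le> x"
      using Cons.prems(2) partition_bounds[OF Cons.hyps(2)] by auto
    then consider "x \<in> set P" | "x \<in> set (tl Q)"
      using PQ(3) by auto
    then show "x \<in> set Q"
    proof cases
      case 1
      then have "x = c" using le partition_bounds[OF PQ(1)] by fastforce
      then show ?thesis using partition_hd_in[OF PQ(2)] by simp
    next
      case 2
      then show ?thesis by (cases Q) auto
    qed
  qed
  then have IH: "norm (rs_sum C f g (c # r) (\<lambda>k. \<xi> (Suc k)) - left_sum C f g Q)
      \<le> K * \<epsilon> * chain_sum (\<lambda>x y. norm (g y - g x)) Q"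
    using Cons.prems Cons.hyps(1) by (intro Cons.IH PQ(2)) auto
  have "norm (C (f (\<xi> 0)) (g c - g a) - left_sum C f g P)
      \<le> K * \<epsilon> * chain_sum (\<lambda>x y. norm (g y - g x)) P"
    using Cons.prems Cons.hyps(1) \<open>c \<le> b\<close>
    by (intro left_sum_osc_bound C K PQ(1) Cons.prems(5)) auto
  with IH have "norm ((C (f (\<xi> 0)) (g c - g a) - left_sum C f g P)
        + (rs_sum C f g (c # r) (\<lambda>k. \<xi> (Suc k)) - left_sum C f g Q))
      \<le> K * \<epsilon> * chain_sum (\<lambda>x y. norm (g y - g x)) P + K * \<epsilon> * chain_sum (\<lambda>x y. norm (g y - g x)) Q"
    by (intro norm_triangle_mono)
  then show ?case
    unfolding PQ(3) partition_join(2)[OF PQ(1,2)] by (simp add: algebra_simps)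
qed

lemma common_refinement:
  assumes "is_partition a b ts" "is_partition a b us"
  obtains ws where "is_partition a b ws" "set ts \<subseteq> set ws" "set us \<subseteq> set ws"
proof -
  define ws where "ws = sorted_list_of_set (set ts \<union> set us)"
  have S: "set ws = set ts \<union> set us" by (simp add: ws_def)
  have bnd: "a \<le> x \<and> x \<le> b" if "x \<in> set ws" for x
    using that S partition_bounds[OF assms(1)] partition_bounds[OF assms(2)] by auto
  have ab: "a \<in> set ws" "b \<in> set ws"
    using assms(1) by (auto simp: S is_partition_def)
  then have ne: "ws \<noteq> []" by auto
  have sorted: "sorted_wrt (<) ws" by (simp add: ws_def)
  have "hd ws \<le> a"
    using sorted ab ne by (cases ws) auto
  moreover have "b \<le> last ws"
  proof -
    have "sorted_wrt (<) (butlast ws @ [last ws])" "b \<in> set (butlast ws @ [last ws])"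
      using sorted ab ne by auto
    then show ?thesis unfolding sorted_wrt_append by auto
  qed
  ultimately have "is_partition a b ws"
    using bnd[of "hd ws"] bnd[of "last ws"] ne sorted by (auto simp: is_partition_def)
  with S that show ?thesis by blast
qed

text \<open>Two fine tagged sums are close because both are close to the left sum on a common
  refinement. Completeness yields a limit along one sequence of partitions, and the same estimate
  extends it to all fine tagged partitions.\<close>

lemma rs_integrable_continuous_bv:
  fixes C :: "'a::real_normed_vector \<Rightarrow> 'b::real_normed_vector \<Rightarrow> 'c::banach"
  assumes C: "bounded_bilinear C" and f: "continuous_on {a..b} f" and "a \<le> b"
    and V: "\<And>D. is_partition a b D \<Longrightarrow> chain_sum (\<lambda>x y. norm (g y - g x)) D \<le> V"
  shows "rs_integrable C f g a b"
proof -
  obtain K where K: "0 < K" "\<And>x y. norm (C x y) \<le> K * norm x * norm y"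
    using bounded_bilinear.pos_bounded[OF C] by (metis mult.commute mult.left_commute)
  obtain D where "is_partition a b D"
    using fine_partition_exists[OF \<open>a \<le> b\<close>, of 1] by auto
  then have "0 \<le> V"
    using V[of D] chain_sum_nonneg[of "\<lambda>x y. norm (g y - g x)" D] by simp
  have key: "\<exists>\<delta>>0. \<forall>ts \<xi> us \<zeta>. is_partition a b ts \<and> mesh ts \<le> \<delta> \<and> tags ts \<xi> \<and>
      is_partition a b us \<and> mesh us \<le> \<delta> \<and> tags us \<zeta> \<longrightarrow>
      norm (rs_sum C f g ts \<xi> - rs_sum C f g us \<zeta>) < e" if "0 < e" for e
  proof -
    \<comment> \<open>Each of the two comparisons costs at most \<open>K * \<epsilon> * V\<close>,
      which is below \<open>e / 2\<close>; \<open>V + 1\<close> guards against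
      \<open>V = 0\<close>.\<close>
    define \<epsilon> where "\<epsilon> = e / (4 * K * (V + 1))"
    have "0 < \<epsilon>" using that K \<open>0 \<le> V\<close> by (simp add: \<epsilon>_def)
    have "uniformly_continuous_on {a..b} f"
      using f compact_uniformly_continuous by blast
    then obtain d where d: "0 < d" "\<And>x y. x \<in> {a..b} \<Longrightarrow> y \<in> {a..b} \<Longrightarrow> dist y x < d \<Longrightarrow> dist (f y) (f x) < \<epsilon>"
      using \<open>0 < \<epsilon>\<close> unfolding uniformly_continuous_on_def by metis
    \<comment> \<open>Halving \<open>d\<close> turns the strict bound of uniform continuity into the
      non-strict one used for meshes.\<close>
    have osc: "norm (f x - f y) \<le> \<epsilon>" if "x \<in> {a..b}" "y \<in> {a..b}" "\<bar>x - y\<bar> \<le> d / 2" for x y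
      using d(2)[of y x] that d(1) by (simp add: dist_norm)
    have "norm (rs_sum C f g ts \<xi> - rs_sum C f g us \<zeta>) < e"
      if ts: "is_partition a b ts" "mesh ts \<le> d / 2" "tags ts \<xi>"
        and us: "is_partition a b us" "mesh us \<le> d / 2" "tags us \<zeta>" for ts \<xi> us \<zeta>
    proof -
      obtain ws where ws: "is_partition a b ws" "set ts \<subseteq> set ws" "set us \<subseteq> set ws"
        using common_refinement ts(1) us(1) by blast
      let ?S = "chain_sum (\<lambda>x y. norm (g y - g x)) ws"
      have "norm (rs_sum C f g ts \<xi> - left_sum C f g ws) \<le> K * \<epsilon> * ?S"
        using K ts ws osc by (intro rs_sum_refine_bound[OF C]) auto
      moreover have "norm (rs_sum C f g us \<zeta> - left_sum C f g ws) \<le> K * \<epsilon> * ?S"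
        using K us ws osc by (intro rs_sum_refine_bound[OF C]) auto
      moreover have "K * \<epsilon> * ?S \<le> K * \<epsilon> * V"
        using V[OF ws(1)] K \<open>0 < \<epsilon>\<close> by (intro mult_left_mono) auto
      moreover have "K * \<epsilon> * V < e / 2"
        using K \<open>0 \<le> V\<close> that \<open>0 < e\<close> by (simp add: \<epsilon>_def field_simps add_pos_nonneg)
      ultimately have "norm (rs_sum C f g ts \<xi> - left_sum C f g ws) < e / 2"
        "norm (rs_sum C f g us \<zeta> - left_sum C f g ws) < e / 2" by linarith+
      then show ?thesis by (rule norm_triangle_half_l)
    qed
    then show ?thesis using d(1) by (intro exI[of _ "d / 2"]) auto
  qed
  have "\<exists>ts. is_partition a b ts \<and> mesh ts \<le> 1 / real (Suc n)" for n
    using fine_partition_exists[OF \<open>a \<le> b\<close>, of "1 / real (Suc n)"] by auto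
  then obtain D where D: "\<And>n. is_partition a b (D n)" "\<And>n. mesh (D n) \<le> 1 / real (Suc n)"
    by metis
  define S where "S n = rs_sum C f g (D n) ((!) (D n))" for n
  have close: "\<exists>\<delta>>0. \<exists>N. \<forall>n\<ge>N. \<forall>ts \<xi>. is_partition a b ts \<and> mesh ts \<le> \<delta> \<and> tags ts \<xi> \<longrightarrow>
      norm (rs_sum C f g ts \<xi> - S n) < e \<and> mesh (D n) \<le> \<delta>" if e: "0 < e" for e
  proof -
    obtain \<delta> where \<delta>: "0 < \<delta>" "\<And>ts \<xi> us \<zeta>. is_partition a b ts \<Longrightarrow> mesh ts \<le> \<delta> \<Longrightarrow> tags ts \<xi> \<Longrightarrow>
      is_partition a b us \<Longrightarrow> mesh us \<le> \<delta> \<Longrightarrow> tags us \<zeta> \<Longrightarrow>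
      norm (rs_sum C f g ts \<xi> - rs_sum C f g us \<zeta>) < e"
      using key[OF e] by blast
    obtain N where N: "1 / real (Suc N) < \<delta>"
      using nat_approx_posE[OF \<delta>(1)] by auto
    have "mesh (D n) \<le> \<delta>" if "N \<le> n" for n
    proof -
      have "1 / real (Suc n) \<le> 1 / real (Suc N)"
        using that by (simp add: frac_le)
      then show ?thesis using D(2)[of n] N by linarith
    qed
    with \<delta> D(1) tags_left[OF D(1)] show ?thesis
      unfolding S_def by (intro exI[of _ \<delta>] conjI exI[of _ N]) auto
  qed
  have "Cauchy S"
  proof (rule metric_CauchyI)
    fix e :: real assume "0 < e"
    then obtain \<delta> N where N: "\<And>n ts \<xi>. n \<ge> N \<Longrightarrow> is_partition a b ts \<Longrightarrow> mesh ts \<le> \<delta> \<Longrightarrow> tags ts \<xi> \<Longrightarrow>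
      norm (rs_sum C f g ts \<xi> - S n) < e \<and> mesh (D n) \<le> \<delta>" "0 < \<delta>"
      using close by metis
    \<comment> \<open>Only a witness: the bound on \<open>mesh (D m)\<close> was packed into
      \<open>close\<close> behind the premise that some fine tagged partition is given.\<close>
    obtain ts where ts: "is_partition a b ts" "mesh ts \<le> \<delta>"
      using fine_partition_exists[OF \<open>a \<le> b\<close> \<open>0 < \<delta>\<close>] .
    have "norm (S m - S n) < e" if "m \<ge> N" "n \<ge> N" for m n
    proof -
      have "mesh (D m) \<le> \<delta>"
        using N(1)[OF that(1) ts tags_left[OF ts(1)]] by simp
      then show ?thesis
        using N(1)[OF that(2) D(1) _ tags_left[OF D(1)], of m] by (simp add: S_def)
    qed
    then show "\<exists>N. \<forall>m\<ge>N. \<forall>n\<ge>N. dist (S m) (S n) < e"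
      by (auto simp: dist_norm)
  qed
  then obtain I where I: "S \<longlonglongrightarrow> I"
    by (auto simp: Cauchy_convergent_iff convergent_def)
  have "has_rs_integral C f g a b I"
    unfolding has_rs_integral_tags
  proof (intro allI impI)
    fix e :: real assume "0 < e"
    then obtain \<delta> N where N: "0 < \<delta>" "\<And>n ts \<xi>. n \<ge> N \<Longrightarrow> is_partition a b ts \<Longrightarrow> mesh ts \<le> \<delta> \<Longrightarrow> tags ts \<xi> \<Longrightarrow>
      norm (rs_sum C f g ts \<xi> - S n) < e / 2"
      using close[of "e / 2"] by (metis half_gt_zero)
    obtain M where M: "\<And>n. n \<ge> M \<Longrightarrow> norm (S n - I) < e / 2"
      using I \<open>0 < e\<close> unfolding LIMSEQ_iff by (meson half_gt_zero)
    have "norm (rs_sum C f g ts \<xi> - I) < e"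
      if "is_partition a b ts" "mesh ts \<le> \<delta>" "tags ts \<xi>" for ts \<xi>
    proof -
      have "norm (rs_sum C f g ts \<xi> - S (max M N)) < e / 2"
        using N(2)[OF _ that] by simp
      moreover have "norm (I - S (max M N)) < e / 2"
        using M[of "max M N"] by (simp add: norm_minus_commute)
      ultimately show ?thesis by (rule norm_triangle_half_l)
    qed
    with N(1) show "\<exists>\<delta>>0. \<forall>ts \<xi>. is_partition a b ts \<and> mesh ts \<le> \<delta> \<and> tags ts \<xi> \<longrightarrow>
      norm (rs_sum C f g ts \<xi> - I) < e" by blast
  qed
  then show ?thesis unfolding rs_integrable_def by blast
qed

section \<open>Chen's relation and its iteration along a partition\<close>

text \<open>Changing the base point alters the integrand by a constant, whose integral telescopes.
  This is the source of the cross term in Chen's relation.\<close>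

lemma left_sum_shift:
  assumes "bounded_bilinear C" "is_partition a b ts"
  shows "left_sum C (\<lambda>x. f x - c) g ts = left_sum C (\<lambda>x. f x - d) g ts + C (d - c) (g b - g a)"
proof -
  interpret bounded_bilinear C by fact
  have "left_sum C (\<lambda>x. f x - c) g ts - left_sum C (\<lambda>x. f x - d) g ts
      = chain_sum (\<lambda>x y. C (d - c) (g y - g x)) ts"
    by (simp add: chain_sum_diff flip: diff_left)
  then show ?thesis
    by (simp add: chain_sum_right chain_sum_telescope[OF assms(2)] algebra_simps)
qed

text \<open>Fine partitions of [s, u] and [u, t] are glued at \<open>u\<close>; on the second one
  the base point moves from \<open>g u\<close> to \<open>g s\<close>.\<close>

lemma rs_integral_chen:
  assumes C: "bounded_bilinear C" and "s \<le> u" "u \<le> t"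
    and I1: "has_rs_integral C (\<lambda>x. g x - g s) g s u I1"
    and I2: "has_rs_integral C (\<lambda>x. g x - g u) g u t I2"
    and I: "has_rs_integral C (\<lambda>x. g x - g s) g s t I"
  shows "I = I1 + I2 + C (g u - g s) (g t - g u)"
proof -
  \<comment> \<open>The summand 0 matches the shape of \<open>field_le_epsilon\<close>, which then
    gives the bound 0.\<close>
  have "norm (I - (I1 + I2 + C (g u - g s) (g t - g u))) \<le> 0 + e" if "0 < e" for e
  proof -
    from that have e: "0 < e / 3" by simp
    obtain \<delta>1 where 1: "0 < \<delta>1" "\<And>ts. is_partition s u ts \<Longrightarrow> mesh ts \<le> \<delta>1 \<Longrightarrow>
        norm (left_sum C (\<lambda>x. g x - g s) g ts - I1) < e / 3"
      using has_rs_integral_left[OF I1 e] by blast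
    obtain \<delta>2 where 2: "0 < \<delta>2" "\<And>ts. is_partition u t ts \<Longrightarrow> mesh ts \<le> \<delta>2 \<Longrightarrow>
        norm (left_sum C (\<lambda>x. g x - g u) g ts - I2) < e / 3"
      using has_rs_integral_left[OF I2 e] by blast
    obtain \<delta>3 where 3: "0 < \<delta>3" "\<And>ts. is_partition s t ts \<Longrightarrow> mesh ts \<le> \<delta>3 \<Longrightarrow>
        norm (left_sum C (\<lambda>x. g x - g s) g ts - I) < e / 3"
      using has_rs_integral_left[OF I e] by blast
    define \<delta> where "\<delta> = min \<delta>1 (min \<delta>2 \<delta>3)"
    have \<delta>: "0 < \<delta>" "\<delta> \<le> \<delta>1" "\<delta> \<le> \<delta>2" "\<delta> \<le> \<delta>3" using 1 2 3 by (auto simp: \<delta>_def)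
    obtain P where P: "is_partition s u P" "mesh P \<le> \<delta>"
      using fine_partition_exists[OF \<open>s \<le> u\<close> \<delta>(1)] .
    obtain Q where Q: "is_partition u t Q" "mesh Q \<le> \<delta>"
      using fine_partition_exists[OF \<open>u \<le> t\<close> \<delta>(1)] .
    note J = partition_join[OF P(1) Q(1)]
    have "norm (left_sum C (\<lambda>x. g x - g s) g P - I1) < e / 3"
      using P \<delta> by (intro 1(2)) auto
    moreover have "norm (left_sum C (\<lambda>x. g x - g u) g Q - I2) < e / 3"
      using Q \<delta> by (intro 2(2)) auto
    moreover have "norm (left_sum C (\<lambda>x. g x - g s) g (P @ tl Q) - I) < e / 3"
      using P Q \<delta> J by (intro 3(2)) auto
    moreover have "left_sum C (\<lambda>x. g x - g s) g (P @ tl Q)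
        = left_sum C (\<lambda>x. g x - g s) g P + left_sum C (\<lambda>x. g x - g u) g Q + C (g u - g s) (g t - g u)"
      unfolding J(2) left_sum_shift[OF C Q(1), of g "g s" g "g u"] by (simp add: add.assoc)
    moreover have tri: "norm (I - (I1 + I2 + Z)) \<le> e"
      if "norm (p - I1) < e / 3" "norm (q - I2) < e / 3" "norm (p + q + Z - I) < e / 3" for p q Z
    proof -
      have "norm (I - (I1 + I2 + Z)) = norm ((p - I1) + (q - I2) - (p + q + Z - I))"
        by (simp add: algebra_simps)
      also have "\<dots> \<le> norm (p - I1) + norm (q - I2) + norm (p + q + Z - I)"
        by (meson norm_triangle_ineq norm_triangle_ineq4 add_right_mono order_trans)
      finally show ?thesis using that by linarith
    qed
    ultimately show ?thesis unfolding add_0_left by (intro tri) simp_all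
  qed
  then have "norm (I - (I1 + I2 + C (g u - g s) (g t - g u))) \<le> 0"
    by (rule field_le_epsilon)
  then show ?thesis by simp
qed

text \<open>Chen's relation is applied at the first partition point after \<open>s\<close>, then to
  the rest. The cross terms, brought to the common base point \<open>g s\<close>, add up to the left
  sum.\<close>

lemma chen_chain_sum:
  fixes \<alpha> :: "real \<Rightarrow> real \<Rightarrow> 'c::real_normed_vector"
  assumes C: "bounded_bilinear C" and "is_partition s t ts" "0 \<le> s" "t \<le> T"
    and chen: "\<And>s u t. 0 \<le> s \<Longrightarrow> s < u \<Longrightarrow> u \<le> t \<Longrightarrow> t \<le> T \<Longrightarrow>
      \<alpha> s t = \<alpha> s u + \<alpha> u t + (1/2) *\<^sub>R C (g u - g s) (g t - g u)"
    and zero: "\<And>t. t \<in> {0..T} \<Longrightarrow> \<alpha> t t = 0"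
  shows "\<alpha> s t = chain_sum \<alpha> ts + (1/2) *\<^sub>R left_sum C (\<lambda>x. g x - g s) g ts"
  using assms(2-4)
proof (induction rule: partition_induct)
  case single
  then show ?case by (simp add: zero)
next
  case (Cons a c r)
  interpret bounded_bilinear C by fact
  have "\<alpha> a t = \<alpha> a c + \<alpha> c t + (1/2) *\<^sub>R C (g c - g a) (g t - g c)"
    using Cons partition_le by (intro chen) auto
  also have "\<alpha> c t = chain_sum \<alpha> (c # r) + (1/2) *\<^sub>R left_sum C (\<lambda>x. g x - g c) g (c # r)"
    using Cons by auto
  finally show ?case
    using left_sum_shift[OF C Cons.hyps(2), of g "g a" g "g c"]
    by (simp add: zero_left scaleR_add_right)
qed

section \<open>Error estimates over partitions\<close>

text \<open>Each integral is replaced by a left sum on a finer partition, whose integrand is at most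
  \<epsilon> because its base point is the left end of the interval. The replacement errors share
  \<eta> by repeated halving; the finer partitions join to \<open>us\<close>, which therefore
  depends on \<eta>.\<close>

lemma sum_rs_integrals_bound:
  assumes C: "bounded_bilinear C" and K: "\<And>x y. norm (C x y) \<le> K * norm x * norm y" "0 \<le> K"
    and "is_partition a b ts" "mesh ts \<le> \<delta>"
    and I: "\<And>s t. a \<le> s \<Longrightarrow> s \<le> t \<Longrightarrow> t \<le> b \<Longrightarrow> has_rs_integral C (\<lambda>x. g x - g s) g s t (I s t)"
    and osc: "\<And>x y. x \<in> {a..b} \<Longrightarrow> y \<in> {a..b} \<Longrightarrow> \<bar>x - y\<bar> \<le> \<delta> \<Longrightarrow> norm (g x - g y) \<le> \<epsilon>"
    and "0 < \<eta>"
  shows "\<exists>us. is_partition a b us \<and>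
    chain_sum (\<lambda>x y. norm (I x y)) ts \<le> K * \<epsilon> * chain_sum (\<lambda>x y. norm (g y - g x)) us + \<eta>"
  using assms(4-)
proof (induction arbitrary: \<eta> rule: partition_induct)
  case single
  then show ?case by (intro exI[of _ "[b]"]) auto
next
  case (Cons a c r)
  interpret bounded_bilinear C by fact
  have "c \<le> b" using Cons.hyps partition_le by blast
  obtain Q where Q: "is_partition c b Q"
      "chain_sum (\<lambda>x y. norm (I x y)) (c # r) \<le> K * \<epsilon> * chain_sum (\<lambda>x y. norm (g y - g x)) Q + \<eta> / 2"
    using Cons.IH[of "\<eta> / 2"] Cons.prems Cons.hyps(1) by auto
  have "has_rs_integral C (\<lambda>x. g x - g a) g a c (I a c)"
    using Cons.prems Cons.hyps(1) \<open>c \<le> b\<close> by auto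
  then obtain d where d: "0 < d" "\<And>ts. is_partition a c ts \<Longrightarrow> mesh ts \<le> d \<Longrightarrow>
      norm (left_sum C (\<lambda>x. g x - g a) g ts - I a c) < \<eta> / 2"
    using has_rs_integral_left[of C "\<lambda>x. g x - g a" g a c "I a c" "\<eta> / 2"] \<open>0 < \<eta>\<close> by auto
  obtain P where P: "is_partition a c P" "mesh P \<le> d"
    using fine_partition_exists[OF less_imp_le[OF Cons.hyps(1)] d(1)] .
  have "norm (C 0 (g c - g a) - left_sum C (\<lambda>x. g x - g a) g P)
      \<le> K * \<epsilon> * chain_sum (\<lambda>x y. norm (g y - g x)) P"
  proof (rule left_sum_osc_bound[OF C K(1) P(1) _ K(2)])
    fix x assume "x \<in> {a..c}"
    then show "norm (0 - (g x - g a)) \<le> \<epsilon>"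
      using Cons.prems(3)[of a x] Cons.prems(1) \<open>c \<le> b\<close> by simp
  qed
  then have "norm (left_sum C (\<lambda>x. g x - g a) g P) \<le> K * \<epsilon> * chain_sum (\<lambda>x y. norm (g y - g x)) P"
    by (simp add: zero_left)
  with d(2)[OF P] have "norm (I a c) \<le> K * \<epsilon> * chain_sum (\<lambda>x y. norm (g y - g x)) P + \<eta> / 2"
    using norm_triangle_sub[of "I a c" "left_sum C (\<lambda>x. g x - g a) g P"]
    by (simp add: norm_minus_commute)
  with Q(2) have "chain_sum (\<lambda>x y. norm (I x y)) (a # c # r)
      \<le> K * \<epsilon> * chain_sum (\<lambda>x y. norm (g y - g x)) (P @ tl Q) + \<eta>"
    unfolding partition_join(2)[OF P(1) Q(1)] by (simp add: distrib_left)
  with partition_join(1)[OF P(1) Q(1)] show ?case by blast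
qed

text \<open>AM-GM splits the error into squared increments of \<^term>\<open>f\<close> along the partition refined by
  the tags and squared increments of \<^term>\<open>g\<close> along the original partition.\<close>

lemma rs_sum_tag_error:
  assumes C: "bounded_bilinear C" and K: "\<And>x y. norm (C x y) \<le> K * norm x * norm y" "0 \<le> K"
    and "is_partition a b ts" "tags ts \<xi>"
  shows "\<exists>us. is_partition a b us \<and> mesh us \<le> mesh ts \<and>
    norm (rs_sum C f g ts \<xi> - left_sum C f g ts) \<le> K / 2 *
      (chain_sum (\<lambda>x y. (norm (f y - f x))\<^sup>2) us + chain_sum (\<lambda>x y. (norm (g y - g x))\<^sup>2) ts)"
  using assms(4-)
proof (induction arbitrary: \<xi> rule: partition_induct)
  case single
  then show ?case by (intro exI[of _ "[b]"]) auto
next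
  case (Cons a c r)
  interpret bounded_bilinear C by fact
  let ?F = "chain_sum (\<lambda>x y. (norm (f y - f x))\<^sup>2)" and ?G = "chain_sum (\<lambda>x y. (norm (g y - g x))\<^sup>2)"
  let ?r = "rs_sum C f g (c # r) (\<lambda>k. \<xi> (Suc k)) - left_sum C f g (c # r)"
  let ?z = "\<xi> 0"
  obtain us where us: "is_partition c b us" "mesh us \<le> mesh (c # r)"
    "norm ?r \<le> K / 2 * (?F us + ?G (c # r))"
    using Cons.IH[of "\<lambda>k. \<xi> (Suc k)"] Cons.prems by auto
  have z: "a \<le> ?z" "?z \<le> c" using Cons.prems by auto
  \<comment> \<open>A tag strictly inside becomes a new point. At \<open>a\<close> the square is 0,
    and at \<open>c\<close> it is the term of \<open>[a, c]\<close> itself, so no degenerate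
    interval is created.\<close>
  obtain P where P: "is_partition a c P" "mesh P \<le> c - a" "(norm (f ?z - f a))\<^sup>2 \<le> ?F P"
  proof (cases "?z = a \<or> ?z = c")
    case True
    with that[of "[a, c]"] Cons.hyps(1) show ?thesis by auto
  next
    case False
    with that[of "[a, ?z, c]"] Cons.hyps(1) z show ?thesis by auto
  qed
  note J = partition_join[OF P(1) us(1)]
  have "norm (C (f ?z - f a) (g c - g a)) \<le> K * (norm (f ?z - f a) * norm (g c - g a))"
    using K(1)[of "f ?z - f a" "g c - g a"] by (simp add: mult.assoc)
  also have "\<dots> \<le> K * (((norm (f ?z - f a))\<^sup>2 + (norm (g c - g a))\<^sup>2) / 2)"
    using K(2) sum_squares_bound[of "norm (f ?z - f a)" "norm (g c - g a)"]
    by (intro mult_left_mono) auto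
  also have "\<dots> \<le> K * ((?F P + (norm (g c - g a))\<^sup>2) / 2)"
    using K(2) P(3) by (intro mult_left_mono) auto
  finally have "norm (C (f ?z - f a) (g c - g a)) \<le> K / 2 * (?F P + (norm (g c - g a))\<^sup>2)"
    by simp
  with us(3) have "norm (C (f ?z - f a) (g c - g a) + ?r)
      \<le> K / 2 * (?F P + (norm (g c - g a))\<^sup>2) + K / 2 * (?F us + ?G (c # r))"
    by (intro norm_triangle_mono)
  moreover have "rs_sum C f g (a # c # r) \<xi> - left_sum C f g (a # c # r)
      = C (f ?z - f a) (g c - g a) + ?r"
    by (simp add: diff_left)
  ultimately have "norm (rs_sum C f g (a # c # r) \<xi> - left_sum C f g (a # c # r))
      \<le> K / 2 * (?F (P @ tl us) + ?G (a # c # r))"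
    unfolding J(2) by (simp add: algebra_simps)
  moreover have "mesh (P @ tl us) \<le> mesh (a # c # r)"
    unfolding J(3) using P(2) us(2) by auto
  ultimately show ?case using J(1) by blast
qed

section \<open>Variation\<close>

lemma var_sum_nonneg: "0 \<le> var_sum p f D"
  by (simp add: var_sum_def sum_nonneg)

lemma ennreal_powr_less:
  assumes "ennreal_powr x r < ennreal e" "0 < r" "0 < e"
  shows "x < ennreal (e powr (1 / r))"
proof (cases x)
  case (real y)
  with assms have "y powr r < e"
    by (simp add: ennreal_powr_def ennreal_less_iff)
  then have "(y powr r) powr (1 / r) < e powr (1 / r)"
    using assms by (intro powr_less_mono2) auto
  with real assms show ?thesis
    by (simp add: powr_powr ennreal_less_iff)
qed (use assms in \<open>simp add: ennreal_powr_def\<close>)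

lemma p_var_lessD:
  assumes "p_var T p f < ennreal e" "0 < p" "0 < e" "is_partition 0 T D"
  shows "var_sum p f D < e powr p"
proof -
  have "(SUP D\<in>{D. is_partition 0 T D}. ennreal (var_sum p f D)) < ennreal (e powr p)"
    using ennreal_powr_less[of _ "1 / p" e] assms(1-3) unfolding p_var_def by simp
  moreover have "ennreal (var_sum p f D) \<le> (SUP D\<in>{D. is_partition 0 T D}. ennreal (var_sum p f D))"
    using assms(4) by (intro SUP_upper) auto
  ultimately show ?thesis
    using var_sum_nonneg[of p f D] by (metis ennreal_less_iff order_le_less_trans)
qed

lemma C_1var_bounded:
  assumes "g \<in> C_1var T"
  obtains V where "0 \<le> V" "\<And>D. is_partition 0 T D \<Longrightarrow> chain_sum (\<lambda>x y. norm (g y - g x)) D \<le> V"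
proof -
  have lt: "p_var T 1 (increments g) < top" using assms by (simp add: C_1var_def)
  then obtain v where v: "p_var T 1 (increments g) = ennreal v" "0 \<le> v"
    by (metis ennreal_cases less_irrefl)
  \<comment> \<open>\<open>p_var_lessD\<close> wants a strict positive bound, hence
    \<open>v + 1\<close>.\<close>
  have "chain_sum (\<lambda>x y. norm (g y - g x)) D \<le> v + 1" if "is_partition 0 T D" for D
    using p_var_lessD[of T 1 "increments g" "v + 1" D] that v
    by (simp add: ennreal_less_iff var_sum_eq increments_def)
  with v(2) that[of "v + 1"] show ?thesis by simp
qed

lemma vanishing_2_variationD:
  assumes "vanishing_2_variation T g" "0 < e"
  obtains \<delta> where "0 < \<delta>"
    "\<And>D. is_partition 0 T D \<Longrightarrow> mesh D \<le> \<delta> \<Longrightarrow> chain_sum (\<lambda>x y. (norm (g y - g x))\<^sup>2) D < e"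
proof -
  let ?S = "\<lambda>\<delta>. SUP D\<in>{D. is_partition 0 T D \<and> mesh D \<le> \<delta>}. ennreal (var_sum 2 (increments g) D)"
  have "eventually (\<lambda>\<delta>. ?S \<delta> < ennreal e) (at_right 0)"
    using assms order_tendstoD(2)[of ?S 0 _ "ennreal e"] unfolding vanishing_2_variation_def by simp
  then obtain b where b: "0 < b" "\<And>y. 0 < y \<Longrightarrow> y < b \<Longrightarrow> ?S y < ennreal e"
    unfolding eventually_at_right_field by auto
  have "chain_sum (\<lambda>x y. (norm (g y - g x))\<^sup>2) D < e"
    if "is_partition 0 T D" "mesh D \<le> b / 2" for D
  proof -
    have "ennreal (var_sum 2 (increments g) D) \<le> ?S (b / 2)"
      using that by (intro SUP_upper) auto
    also have "\<dots> < ennreal e" using b(1) by (intro b(2)) auto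
    finally have "var_sum 2 (increments g) D < e"
      using var_sum_nonneg[of 2 "increments g" D] by (simp add: ennreal_less_iff)
    then show ?thesis by (simp add: var_sum_eq increments_def)
  qed
  with b(1) that[of "b / 2"] show ?thesis by simp
qed

section \<open>Geometric rough paths\<close>

text \<open>The tensor norm bound applies to each of the two terms, which gives the constant
  2.\<close>

lemma bounded_bilinear_commutator:
  assumes "is_completed_tensor B"
  shows "bounded_bilinear (commutator B)"
proof -
  have "bilinear B" and B: "\<And>v u. norm (B v u) \<le> norm v * norm u"
    using assms by (auto simp: is_completed_tensor_def)
  then have "bounded_bilinear B"
    by (auto simp: bilinear_conv_bounded_bilinear bilinear_def linear_iff
      intro!: bounded_bilinear.intro exI[of _ 1])
  then interpret bounded_bilinear B .
  show ?thesis
  proof (rule bounded_bilinear.intro)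
    show "\<exists>K. \<forall>a b. norm (commutator B a b) \<le> norm a * norm b * K"
    proof (intro exI allI)
      fix a b
      show "norm (commutator B a b) \<le> norm a * norm b * 2"
        using norm_triangle_ineq4[of "B a b" "B b a"] B[of a b] B[of b a]
        by (simp add: commutator_def mult.commute)
    qed
  qed (simp_all add: commutator_def add_left add_right scaleR_left scaleR_right scaleR_diff_right)
qed

text \<open>Gives content to the description behind \<open>area\<close>; the factor 2 cancels its
  1/2.\<close>

lemma area_integral:
  fixes B :: "'v::banach \<Rightarrow> 'v \<Rightarrow> 'w::banach"
  assumes "is_completed_tensor B" "g \<in> C_1var T" "0 \<le> s" "s \<le> t" "t \<le> T"
  shows "has_rs_integral (commutator B) (\<lambda>u. g u - g s) g s t (2 *\<^sub>R area B g s t)"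
proof -
  obtain V where V: "\<And>D. is_partition 0 T D \<Longrightarrow> chain_sum (\<lambda>x y. norm (g y - g x)) D \<le> V"
    using C_1var_bounded[OF assms(2)] by blast
  have "continuous_on {0..T} g" using assms(2) by (simp add: C_1var_def)
  then have "continuous_on {s..t} (\<lambda>u. g u - g s)"
    using assms by (intro continuous_intros) (auto intro: continuous_on_subset)
  moreover have "chain_sum (\<lambda>x y. norm (g y - g x)) D \<le> V" if "is_partition s t D" for D
    using chain_sum_extend_le[OF that, of 0 T "\<lambda>x y. norm (g y - g x)" V] assms V by simp
  ultimately have "rs_integrable (commutator B) (\<lambda>u. g u - g s) g s t"
    using bounded_bilinear_commutator[OF assms(1)] \<open>s \<le> t\<close> by (intro rs_integrable_continuous_bv)
  from has_rs_integral_rs_integral[OF this \<open>s \<le> t\<close>] show ?thesis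
    by (simp add: area_eq)
qed

lemma area_chen:
  fixes B :: "'v::banach \<Rightarrow> 'v \<Rightarrow> 'w::banach"
  assumes "is_completed_tensor B" "g \<in> C_1var T" "0 \<le> s" "s \<le> u" "u \<le> t" "t \<le> T"
  shows "area B g s t = area B g s u + area B g u t + (1/2) *\<^sub>R commutator B (g u - g s) (g t - g u)"
proof -
  have "2 *\<^sub>R area B g s t
      = 2 *\<^sub>R area B g s u + 2 *\<^sub>R area B g u t + commutator B (g u - g s) (g t - g u)"
    using assms
    by (intro rs_integral_chen bounded_bilinear_commutator area_integral[where T = T]) auto
  then have "(1/2) *\<^sub>R 2 *\<^sub>R area B g s t
      = (1/2) *\<^sub>R (2 *\<^sub>R area B g s u + 2 *\<^sub>R area B g u t + commutator B (g u - g s) (g t - g u))"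
    by (rule arg_cong)
  then show ?thesis by (simp add: scaleR_add_right)
qed

lemma area_sum_vanishes:
  fixes B :: "'v::banach \<Rightarrow> 'v \<Rightarrow> 'w::banach"
  assumes B: "is_completed_tensor B" and g: "g \<in> C_1var T" and "0 < e"
  obtains \<delta> where "0 < \<delta>"
    "\<And>D. is_partition 0 T D \<Longrightarrow> mesh D \<le> \<delta> \<Longrightarrow> chain_sum (\<lambda>x y. norm (area B g x y)) D \<le> e"
proof -
  note C = bounded_bilinear_commutator[OF B]
  obtain K where K: "0 < K" "\<And>x y. norm (commutator B x y) \<le> K * norm x * norm y"
    using bounded_bilinear.pos_bounded[OF C] by (metis mult.commute mult.left_commute)
  obtain V where V: "0 \<le> V" "\<And>D. is_partition 0 T D \<Longrightarrow> chain_sum (\<lambda>x y. norm (g y - g x)) D \<le> V"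
    using C_1var_bounded[OF g] by blast
  define \<epsilon> where "\<epsilon> = e / (K * (V + 1))"
  have "0 < \<epsilon>" using \<open>0 < e\<close> K V by (simp add: \<epsilon>_def)
  have "uniformly_continuous_on {0..T} g"
    using g compact_uniformly_continuous by (auto simp: C_1var_def)
  then obtain d where d: "0 < d"
    "\<And>x y. x \<in> {0..T} \<Longrightarrow> y \<in> {0..T} \<Longrightarrow> dist y x < d \<Longrightarrow> dist (g y) (g x) < \<epsilon>"
    using \<open>0 < \<epsilon>\<close> unfolding uniformly_continuous_on_def by metis
  have osc: "norm (g x - g y) \<le> \<epsilon>" if "x \<in> {0..T}" "y \<in> {0..T}" "\<bar>x - y\<bar> \<le> d / 2" for x y
    using d(2)[of y x] that d(1) by (simp add: dist_norm)
  have "chain_sum (\<lambda>x y. norm (area B g x y)) D \<le> e" if D: "is_partition 0 T D" "mesh D \<le> d / 2" for D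
  proof -
    \<comment> \<open>The slack \<eta> is the cost of replacing integrals by left sums; the
      variation bound \<open>V\<close> does not depend on \<open>us\<close>, so \<eta> can be sent
      to 0.\<close>
    have "chain_sum (\<lambda>x y. norm (2 *\<^sub>R area B g x y)) D \<le> K * \<epsilon> * V + \<eta>" if \<eta>: "0 < \<eta>" for \<eta>
    proof -
      obtain us where us: "is_partition 0 T us" "chain_sum (\<lambda>x y. norm (2 *\<^sub>R area B g x y)) D
          \<le> K * \<epsilon> * chain_sum (\<lambda>x y. norm (g y - g x)) us + \<eta>"
        using sum_rs_integrals_bound[OF C K(2) less_imp_le[OF K(1)] D area_integral[OF B g] osc \<eta>]
        by blast
      have "K * \<epsilon> * chain_sum (\<lambda>x y. norm (g y - g x)) us \<le> K * \<epsilon> * V"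
        using V(2)[OF us(1)] K(1) \<open>0 < \<epsilon>\<close> by (intro mult_left_mono) auto
      with us(2) show ?thesis by linarith
    qed
    then have "chain_sum (\<lambda>x y. norm (2 *\<^sub>R area B g x y)) D \<le> K * \<epsilon> * V"
      by (rule field_le_epsilon)
    also have "\<dots> \<le> K * \<epsilon> * (V + 1)"
      using K(1) \<open>0 < \<epsilon>\<close> by (intro mult_left_mono) auto
    also have "\<dots> = e"
      using K(1) V(1) by (simp add: \<epsilon>_def)
    finally have *: "chain_sum (\<lambda>x y. norm (2 *\<^sub>R area B g x y)) D \<le> e" .
    have "chain_sum (\<lambda>x y. norm (area B g x y)) D \<le> chain_sum (\<lambda>x y. norm (2 *\<^sub>R area B g x y)) D"
      by (rule chain_sum_mono) simp
    with * show ?thesis by linarith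
  qed
  with d(1) that[of "d / 2"] show ?thesis by simp
qed

text \<open>If the root of the sum is below \<open>e\<close>, each nonnegative summand is below
  \<open>e\<^sup>2\<close>; one term of the approximating sequence suffices.\<close>

lemma geometric_2_rough_path_approx:
  assumes "geometric_2_rough_path B T \<gamma> \<alpha>" "0 < e"
  shows "\<exists>g. g \<in> C_1var T \<and> (\<forall>D. is_partition 0 T D \<longrightarrow>
      chain_sum (\<lambda>x y. (norm ((\<gamma> y - g y) - (\<gamma> x - g x)))\<^sup>2) D \<le> e\<^sup>2 \<and>
      chain_sum (\<lambda>x y. norm (\<alpha> x y - area B g x y)) D \<le> e\<^sup>2)"
proof -
  define N where "N g = (p_var T 2 (increments (\<lambda>u. \<gamma> u - g u)))\<^sup>2
    + p_var T 1 (\<lambda>s t. \<alpha> s t - area B g s t)" for g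
  obtain gs where gs: "\<And>n. gs n \<in> C_1var T" "(\<lambda>n. ennreal_powr (N (gs n)) (1/2)) \<longlonglongrightarrow> 0"
    using assms(1) unfolding geometric_2_rough_path_def N_def by blast
  have "eventually (\<lambda>n. ennreal_powr (N (gs n)) (1/2) < ennreal e) sequentially"
    using order_tendstoD(2)[OF gs(2), of "ennreal e"] assms(2) by simp
  then obtain n where n: "ennreal_powr (N (gs n)) (1/2) < ennreal e"
    using eventually_happens' by force
  define g where "g = gs n"
  have "N g < ennreal (e\<^sup>2)"
    using ennreal_powr_less[OF n] assms(2) by (simp add: g_def)
  then have 2: "(p_var T 2 (increments (\<lambda>u. \<gamma> u - g u)))\<^sup>2 < ennreal (e\<^sup>2)"
    and 1: "p_var T 1 (\<lambda>s t. \<alpha> s t - area B g s t) < ennreal (e\<^sup>2)"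
    unfolding N_def by (auto intro: order_le_less_trans[rotated])
  have "p_var T 2 (increments (\<lambda>u. \<gamma> u - g u)) < ennreal e"
  proof (rule ccontr)
    assume "\<not> ?thesis"
    then have "(ennreal e)\<^sup>2 \<le> (p_var T 2 (increments (\<lambda>u. \<gamma> u - g u)))\<^sup>2"
      by (intro power_mono) auto
    with 2 assms(2) show False by (simp add: ennreal_power)
  qed
  from p_var_lessD[OF this] assms(2)
  have "chain_sum (\<lambda>x y. (norm ((\<gamma> y - g y) - (\<gamma> x - g x)))\<^sup>2) D \<le> e\<^sup>2" if "is_partition 0 T D" for D
    using that by (fastforce simp: var_sum_eq increments_def intro: less_imp_le)
  moreover from p_var_lessD[OF 1] assms(2)
  have "chain_sum (\<lambda>x y. norm (\<alpha> x y - area B g x y)) D \<le> e\<^sup>2" if "is_partition 0 T D" for D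
    using that by (fastforce simp: var_sum_eq intro: less_imp_le)
  moreover have "g \<in> C_1var T" using gs(1) by (simp add: g_def)
  ultimately show ?thesis by blast
qed

lemma rough_path_sum_vanishes:
  fixes B :: "'v::banach \<Rightarrow> 'v \<Rightarrow> 'w::banach"
  assumes "is_completed_tensor B" "geometric_2_rough_path B T \<gamma> \<alpha>" "0 < e"
  obtains \<delta> where "0 < \<delta>"
    "\<And>D. is_partition 0 T D \<Longrightarrow> mesh D \<le> \<delta> \<Longrightarrow> chain_sum (\<lambda>x y. norm (\<alpha> x y)) D \<le> e"
proof -
  \<comment> \<open>The approximation lemma squares its accuracy, so this leaves
    \<open>e / 2\<close> for \<alpha> minus the area and \<open>e / 2\<close> for the area.\<close>
  have pos: "0 < sqrt (e / 2)" using assms(3) by simp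
  obtain g where g: "g \<in> C_1var T"
    "\<And>D. is_partition 0 T D \<Longrightarrow> chain_sum (\<lambda>x y. norm (\<alpha> x y - area B g x y)) D \<le> (sqrt (e / 2))\<^sup>2"
    using geometric_2_rough_path_approx[OF assms(2) pos] by blast
  obtain \<delta> where \<delta>: "0 < \<delta>"
    "\<And>D. is_partition 0 T D \<Longrightarrow> mesh D \<le> \<delta> \<Longrightarrow> chain_sum (\<lambda>x y. norm (area B g x y)) D \<le> e / 2"
    using area_sum_vanishes[OF assms(1) g(1), of "e / 2"] assms(3) by auto
  have "chain_sum (\<lambda>x y. norm (\<alpha> x y)) D \<le> e" if "is_partition 0 T D" "mesh D \<le> \<delta>" for D
  proof -
    have "chain_sum (\<lambda>x y. norm (\<alpha> x y)) D
        \<le> chain_sum (\<lambda>x y. norm (\<alpha> x y - area B g x y) + norm (area B g x y)) D"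
      by (intro chain_sum_mono) (metis norm_triangle_sub add.commute)
    also have "\<dots> = chain_sum (\<lambda>x y. norm (\<alpha> x y - area B g x y)) D + chain_sum (\<lambda>x y. norm (area B g x y)) D"
      by (simp add: chain_sum_def sum.distrib)
    also have "\<dots> \<le> e" using g(2)[OF that(1)] \<delta>(2)[OF that] assms(3) by simp
    finally show ?thesis .
  qed
  with \<delta>(1) that show ?thesis by blast
qed

text \<open>Variation norms ignore additive constants, so only increments of the approximating paths
  converge; Chen's relation involves nothing else of the paths. For \<open>u = t\<close> it is
  trivial, and otherwise all intervals are nondegenerate.\<close>

lemma rough_path_chen:
  fixes B :: "'v::banach \<Rightarrow> 'v \<Rightarrow> 'w::banach"
  assumes B: "is_completed_tensor B" and \<alpha>: "geometric_2_rough_path B T \<gamma> \<alpha>"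
    and "0 \<le> s" "s < u" "u \<le> t" "t \<le> T"
  shows "\<alpha> s t = \<alpha> s u + \<alpha> u t + (1/2) *\<^sub>R commutator B (\<gamma> u - \<gamma> s) (\<gamma> t - \<gamma> u)"
proof (cases "u = t")
  case True
  then show ?thesis
    using assms bounded_bilinear.zero_right[OF bounded_bilinear_commutator[OF B]]
    by (auto simp: geometric_2_rough_path_def C_triangle_def)
next
  case False
  interpret bounded_bilinear "commutator B"
    using B by (rule bounded_bilinear_commutator)
  define close where "close n g \<longleftrightarrow> g \<in> C_1var T \<and> (\<forall>D. is_partition 0 T D \<longrightarrow>
      chain_sum (\<lambda>x y. (norm ((\<gamma> y - g y) - (\<gamma> x - g x)))\<^sup>2) D \<le> (1 / real (Suc n))\<^sup>2 \<and>
      chain_sum (\<lambda>x y. norm (\<alpha> x y - area B g x y)) D \<le> (1 / real (Suc n))\<^sup>2)" for n g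
  have "\<exists>g. close n g" for n
  proof -
    have "0 < 1 / real (Suc n)" by simp
    from geometric_2_rough_path_approx[OF \<alpha> this] show ?thesis unfolding close_def .
  qed
  then obtain g where "\<And>n. close n (g n)" by metis
  then have g: "\<And>n. g n \<in> C_1var T"
    "\<And>n D. is_partition 0 T D \<Longrightarrow>
      chain_sum (\<lambda>x y. (norm ((\<gamma> y - g n y) - (\<gamma> x - g n x)))\<^sup>2) D \<le> (1 / real (Suc n))\<^sup>2"
    "\<And>n D. is_partition 0 T D \<Longrightarrow>
      chain_sum (\<lambda>x y. norm (\<alpha> x y - area B (g n) x y)) D \<le> (1 / real (Suc n))\<^sup>2"
    unfolding close_def by blast+
  have lim: "(\<lambda>n. 1 / real (Suc n)) \<longlonglongrightarrow> 0"
    using LIMSEQ_inverse_real_of_nat by (simp add: inverse_eq_divide)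
  have lim2: "(\<lambda>n. (1 / real (Suc n))\<^sup>2) \<longlonglongrightarrow> 0"
    using tendsto_power[OF lim, of 2] by simp
  \<comment> \<open>A variation norm controls a single value: \<open>[x, y]\<close> is a partition
    of its interval and extends to one of [0, T].\<close>
  have area_lim: "(\<lambda>n. area B (g n) x y) \<longlonglongrightarrow> \<alpha> x y" if xy: "0 \<le> x" "x < y" "y \<le> T" for x y
  proof (rule LIM_zero_cancel, rule Lim_null_comparison[OF _ lim2], rule always_eventually, rule allI)
    fix n
    show "norm (area B (g n) x y - \<alpha> x y) \<le> (1 / real (Suc n))\<^sup>2"
      using chain_sum_extend_le[of x y "[x, y]" 0 T "\<lambda>x y. norm (\<alpha> x y - area B (g n) x y)" "(1 / real (Suc n))\<^sup>2"]
        g(3) xy by (simp add: norm_minus_commute)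
  qed
  have incr_lim: "(\<lambda>n. g n y - g n x) \<longlonglongrightarrow> \<gamma> y - \<gamma> x" if xy: "0 \<le> x" "x < y" "y \<le> T" for x y
  proof (rule LIM_zero_cancel, rule Lim_null_comparison[OF _ lim], rule always_eventually, rule allI)
    fix n
    have "(norm ((\<gamma> y - g n y) - (\<gamma> x - g n x)))\<^sup>2 \<le> (1 / real (Suc n))\<^sup>2"
      using chain_sum_extend_le[of x y "[x, y]" 0 T
          "\<lambda>x y. (norm ((\<gamma> y - g n y) - (\<gamma> x - g n x)))\<^sup>2" "(1 / real (Suc n))\<^sup>2"]
        g(2) xy by simp
    then have "norm ((\<gamma> y - g n y) - (\<gamma> x - g n x)) \<le> 1 / real (Suc n)"
      by (rule power2_le_imp_le) simp
    then show "norm (g n y - g n x - (\<gamma> y - \<gamma> x)) \<le> 1 / real (Suc n)"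
      by (subst norm_minus_commute) (simp add: algebra_simps)
  qed
  have "(\<lambda>n. area B (g n) s u + area B (g n) u t
        + (1/2) *\<^sub>R commutator B (g n u - g n s) (g n t - g n u))
      \<longlonglongrightarrow> \<alpha> s u + \<alpha> u t + (1/2) *\<^sub>R commutator B (\<gamma> u - \<gamma> s) (\<gamma> t - \<gamma> u)"
    using assms False by (intro tendsto_add area_lim tendsto_scaleR tendsto_const tendsto incr_lim) auto
  moreover have "area B (g n) s t = area B (g n) s u + area B (g n) u t
        + (1/2) *\<^sub>R commutator B (g n u - g n s) (g n t - g n u)" for n
    using assms by (intro area_chen[OF B g(1)]) auto
  ultimately show ?thesis
    using area_lim[of s t] assms LIMSEQ_unique by fastforce
qed

lemma rough_path_has_rs_integral:
  fixes B :: "'v::banach \<Rightarrow> 'v \<Rightarrow> 'w::banach"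
  assumes B: "is_completed_tensor B" and van: "vanishing_2_variation T \<gamma>"
    and \<alpha>: "geometric_2_rough_path B T \<gamma> \<alpha>" and st: "0 \<le> s" "s \<le> t" "t \<le> T"
  shows "has_rs_integral (commutator B) (\<lambda>u. \<gamma> u - \<gamma> s) \<gamma> s t (2 *\<^sub>R \<alpha> s t)"
  unfolding has_rs_integral_tags
proof (intro allI impI)
  fix e :: real assume "0 < e"
  let ?C = "commutator B" and ?f = "\<lambda>u. \<gamma> u - \<gamma> s"
  let ?Q = "chain_sum (\<lambda>x y. (norm (\<gamma> y - \<gamma> x))\<^sup>2)"
  note C = bounded_bilinear_commutator[OF B]
  obtain K where K: "0 < K" "\<And>x y. norm (?C x y) \<le> K * norm x * norm y"
    using bounded_bilinear.pos_bounded[OF C] by (metis mult.commute mult.left_commute)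
  \<comment> \<open>Two sums of squares enter the tag error with factor \<open>K / 2\<close>, which
    makes \<open>e / 2\<close> in total.\<close>
  have "0 < e / (2 * K)" using K \<open>0 < e\<close> by simp
  then obtain \<delta>1 where \<delta>1: "0 < \<delta>1" "\<And>D. is_partition 0 T D \<Longrightarrow> mesh D \<le> \<delta>1 \<Longrightarrow> ?Q D < e / (2 * K)"
    using vanishing_2_variationD[OF van] by blast
  \<comment> \<open>The sum of \<alpha> enters the identity doubled, so \<open>e / 4\<close>
    contributes \<open>e / 2\<close>.\<close>
  obtain \<delta>2 where \<delta>2: "0 < \<delta>2" "\<And>D. is_partition 0 T D \<Longrightarrow> mesh D \<le> \<delta>2 \<Longrightarrow>
      chain_sum (\<lambda>x y. norm (\<alpha> x y)) D \<le> e / 4"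
    using rough_path_sum_vanishes[OF B \<alpha>, of "e / 4"] \<open>0 < e\<close> by auto
  have Q: "?Q D < e / (2 * K)" if D: "is_partition s t D" "mesh D \<le> \<delta>1" for D
  proof -
    obtain D' where "is_partition 0 T D'" "mesh D' \<le> \<delta>1" "?Q D \<le> ?Q D'"
      by (rule partition_extend[OF D(1) st(1) st(3) \<delta>1(1) D(2), of "\<lambda>x y. (norm (\<gamma> y - \<gamma> x))\<^sup>2"]) auto
    with \<delta>1(2) show ?thesis by fastforce
  qed
  have A: "chain_sum (\<lambda>x y. norm (\<alpha> x y)) D \<le> e / 4" if D: "is_partition s t D" "mesh D \<le> \<delta>2" for D
  proof -
    obtain D' where "is_partition 0 T D'" "mesh D' \<le> \<delta>2"
      "chain_sum (\<lambda>x y. norm (\<alpha> x y)) D \<le> chain_sum (\<lambda>x y. norm (\<alpha> x y)) D'"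
      by (rule partition_extend[OF D(1) st(1) st(3) \<delta>2(1) D(2), of "\<lambda>x y. norm (\<alpha> x y)"]) auto
    with \<delta>2(2) show ?thesis by fastforce
  qed
  have "norm (rs_sum ?C ?f \<gamma> ts \<xi> - 2 *\<^sub>R \<alpha> s t) < e"
    if ts: "is_partition s t ts" "mesh ts \<le> min \<delta>1 \<delta>2" "tags ts \<xi>" for ts \<xi>
  proof -
    obtain us where us: "is_partition s t us" "mesh us \<le> mesh ts"
      "norm (rs_sum ?C ?f \<gamma> ts \<xi> - left_sum ?C ?f \<gamma> ts) \<le> K / 2 * (?Q us + ?Q ts)"
      using rs_sum_tag_error[OF C K(2) less_imp_le[OF K(1)] ts(1,3), of ?f \<gamma>] by auto
    \<comment> \<open>\<open>us\<close> is no coarser than \<open>ts\<close>, so the same mesh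
      threshold makes both sums of squares small.\<close>
    have "K / 2 * (?Q us + ?Q ts) < K / 2 * (e / (2 * K) + e / (2 * K))"
      using K(1) Q[OF us(1)] Q[OF ts(1)] us(2) ts(2) by (intro mult_strict_left_mono add_strict_mono) auto
    also have "\<dots> = e / 2" using K(1) by simp
    finally have 1: "norm (rs_sum ?C ?f \<gamma> ts \<xi> - left_sum ?C ?f \<gamma> ts) < e / 2"
      using us(3) by linarith
    have "\<alpha> s t = chain_sum \<alpha> ts + (1/2) *\<^sub>R left_sum ?C ?f \<gamma> ts"
      using \<alpha> by (intro chen_chain_sum[OF C ts(1) st(1,3)] rough_path_chen[OF B \<alpha>])
        (auto simp: geometric_2_rough_path_def C_triangle_def)
    then have "2 *\<^sub>R \<alpha> s t - left_sum ?C ?f \<gamma> ts = 2 *\<^sub>R chain_sum \<alpha> ts"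
      by (simp add: scaleR_add_right)
    moreover have "norm (chain_sum \<alpha> ts) \<le> e / 4"
      using norm_chain_sum_le[of \<alpha> ts] A[OF ts(1)] ts(2) by auto
    ultimately have 2: "norm (2 *\<^sub>R \<alpha> s t - left_sum ?C ?f \<gamma> ts) \<le> e / 2"
      by simp
    have "norm (rs_sum ?C ?f \<gamma> ts \<xi> - 2 *\<^sub>R \<alpha> s t)
        \<le> norm (rs_sum ?C ?f \<gamma> ts \<xi> - left_sum ?C ?f \<gamma> ts) + norm (2 *\<^sub>R \<alpha> s t - left_sum ?C ?f \<gamma> ts)"
      using norm_triangle_ineq4[of "rs_sum ?C ?f \<gamma> ts \<xi> - left_sum ?C ?f \<gamma> ts"
          "2 *\<^sub>R \<alpha> s t - left_sum ?C ?f \<gamma> ts"] by simp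
    with 1 2 show ?thesis by linarith
  qed
  then show "\<exists>\<delta>>0. \<forall>ts \<xi>. is_partition s t ts \<and> mesh ts \<le> \<delta> \<and> tags ts \<xi> \<longrightarrow>
      norm (rs_sum ?C ?f \<gamma> ts \<xi> - 2 *\<^sub>R \<alpha> s t) < e"
    using \<delta>1(1) \<delta>2(1) by (intro exI[of _ "min \<delta>1 \<delta>2"]) auto
qed

text \<open>Needed to put the integral in place of \<alpha>, since the two are known to agree only
  on the triangle; sums over partitions of [0, T] never leave it.\<close>

lemma geometric_2_rough_path_cong:
  assumes "geometric_2_rough_path B T \<gamma> \<alpha>"
    and eq: "\<And>s t. 0 \<le> s \<Longrightarrow> s \<le> t \<Longrightarrow> t \<le> T \<Longrightarrow> \<beta> s t = \<alpha> s t"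
  shows "geometric_2_rough_path B T \<gamma> \<beta>"
proof -
  have "var_sum 1 (\<lambda>s t. \<beta> s t - area B g s t) D = var_sum 1 (\<lambda>s t. \<alpha> s t - area B g s t) D"
    if D: "is_partition 0 T D" for D g
    unfolding var_sum_def
  proof (intro sum.cong refl)
    fix j assume "j \<in> {..<length D - 1}"
    then have "\<beta> (D ! j) (D ! Suc j) = \<alpha> (D ! j) (D ! Suc j)"
      using partition_nth_less[OF D, of j] partition_bounds[OF D, of "D ! j"]
        partition_bounds[OF D, of "D ! Suc j"] by (intro eq) auto
    then show "norm (\<beta> (D ! j) (D ! Suc j) - area B g (D ! j) (D ! Suc j)) powr 1
        = norm (\<alpha> (D ! j) (D ! Suc j) - area B g (D ! j) (D ! Suc j)) powr 1" by simp
  qed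
  then have "p_var T 1 (\<lambda>s t. \<beta> s t - area B g s t) = p_var T 1 (\<lambda>s t. \<alpha> s t - area B g s t)" for g
    unfolding p_var_def by simp
  moreover have "\<beta> \<in> C_triangle T (commutator_space B)"
  proof -
    have "\<alpha> \<in> C_triangle T (commutator_space B)"
      using assms(1) by (simp add: geometric_2_rough_path_def)
    moreover have "continuous_on {(s, t). 0 \<le> s \<and> s \<le> t \<and> t \<le> T} (\<lambda>(s, t). \<beta> s t)
        \<longleftrightarrow> continuous_on {(s, t). 0 \<le> s \<and> s \<le> t \<and> t \<le> T} (\<lambda>(s, t). \<alpha> s t)"
      by (intro continuous_on_cong) (auto simp: eq)
    ultimately show ?thesis by (simp add: C_triangle_def eq)
  qed
  ultimately show ?thesis
    using assms(1) by (simp add: geometric_2_rough_path_def)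
qed

theorem mainTheorem8:
  fixes tensor :: "'v::banach \<Rightarrow> 'v \<Rightarrow> 'w::banach"
    and T :: real
    and \<gamma> :: "real \<Rightarrow> 'v"
  assumes "is_completed_tensor tensor"
    and "T > 0"
    and "continuous_on {0..T} \<gamma>"
    and "vanishing_2_variation T \<gamma>"
  shows "(\<forall>\<alpha>. geometric_2_rough_path tensor T \<gamma> \<alpha> \<longrightarrow>
            (\<forall>s t. 0 \<le> s \<and> s \<le> t \<and> t \<le> T \<longrightarrow>
               rs_integrable (commutator tensor) (\<lambda>u. \<gamma> u - \<gamma> s) \<gamma> s t \<and>
               (1/2) *\<^sub>R rs_integral (commutator tensor) (\<lambda>u. \<gamma> u - \<gamma> s) \<gamma> s t = \<alpha> s t)) \<and>
         ((\<exists>s t. 0 \<le> s \<and> s \<le> t \<and> t \<le> T \<and>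
              \<not> rs_integrable (commutator tensor) (\<lambda>u. \<gamma> u - \<gamma> s) \<gamma> s t) \<or>
          \<not> geometric_2_rough_path tensor T \<gamma>
              (\<lambda>s t. (1/2) *\<^sub>R rs_integral (commutator tensor) (\<lambda>u. \<gamma> u - \<gamma> s) \<gamma> s t)
          \<longrightarrow> \<not> can_be_enhanced tensor T \<gamma>)"
proof -
  let ?I = "\<lambda>s t. (1/2) *\<^sub>R rs_integral (commutator tensor) (\<lambda>u. \<gamma> u - \<gamma> s) \<gamma> s t"
  have integral: "rs_integrable (commutator tensor) (\<lambda>u. \<gamma> u - \<gamma> s) \<gamma> s t" "?I s t = \<alpha> s t"
    if "geometric_2_rough_path tensor T \<gamma> \<alpha>" "0 \<le> s" "s \<le> t" "t \<le> T" for \<alpha> s t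
  proof -
    note I = rough_path_has_rs_integral[OF assms(1,4) that]
    then show "rs_integrable (commutator tensor) (\<lambda>u. \<gamma> u - \<gamma> s) \<gamma> s t"
      unfolding rs_integrable_def by blast
    show "?I s t = \<alpha> s t"
      using rs_integral_eq[OF I \<open>s \<le> t\<close>] by simp
  qed
  \<comment> \<open>The second half of the theorem by contraposition: any enhancement forces the
    pair with the integral to be a geometric rough path as well.\<close>
  moreover have "geometric_2_rough_path tensor T \<gamma> ?I" if "geometric_2_rough_path tensor T \<gamma> \<alpha>" for \<alpha>
    using geometric_2_rough_path_cong[OF that, of ?I] integral(2)[OF that] by blast
  ultimately show ?thesis
    unfolding can_be_enhanced_def by blast
qed

end
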